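(* Let $d\in\mathbb{N}$, $d\geq2$ and $f\colon\mathbb{Z}^{d}\to\mathbb{R}^{d}$ be a bilipschitz mapping. Then the following are equivalent: (i) There exists a bilipschitz mapping $F\colon \mathbb{R}^{d}\to \mathbb{R}^{d}$ such that $F|_{\mathbb{Z}^{d}}=f$. (ii) There exist $T\in\mathbb{N}$ and a bilipschitz mapping $G\colon \mathbb{R}^{d}\to\mathbb{R}^{d}$ such that the mapping \[\widetilde{F}\colon \mathbb{Z}^{d}\cup \big(\mathbb{R}^{d-1}\times(T\mathbb{Z}+\tfrac{1}{2})\big)\to \mathbb{R}^{d},\qquad \widetilde{F}(x)=\begin{cases} f(x) & x\in\mathbb{Z}^{d},\\ G(x) & x\in \mathbb{R}^{d-1}\times(T\mathbb{Z}+\frac{1}{2}),\end{cases}\] is bilipschitz and for every $k\in\mathbb{Z}$, \[f\Big(\mathbb{Z}^d\cap \big(\mathbb{R}^{d-1}\times[(k-1)T+\tfrac{1}{2},kT+\tfrac{1}{2}]\big)\Big)\subseteq G\Big(\mathbb{R}^{d-1}\times[(k-1)T+\tfrac{1}{2},kT+\tfrac{1}{2}]\Big).\] Furthermore, there is a monotone increasing function $\beta_{d}\colon [1,\infty)\to [1,\infty)$ with $2\lfloor t\rfloor-1\leq\beta_{d}(t)\leq 2^{8dt}$ for all $t\in [1,\infty)$ such that whenever (ii) holds with $M_{1}\geq \operatorname{bilip}(\widetilde{F})$ and $M_{2}\geq \operatorname{bilip}(G)$, the bilipschitz extension $F$ of $f$ in (i) may be found with \[\operatorname{bilip}(F)\leq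 \beta_{d}\Big(2^{42}d^{9/2}(M_{1}M_{2})^{10}T^{3+\frac{3}{d-1}}\Big)^{3^{d-1}+1}.\] Moreover, $\beta_d$ may be taken to be the function $\beta_d$ defined in the context below.
   Context: For a mapping $f$, $\operatorname{Lip}(f)=\sup_{x\neq y}\|f(y)-f(x)\|/\|y-x\|$ (Euclidean norm); for injective $f$, $\operatorname{bilip}(f)=\max\{\operatorname{Lip}(f),\operatorname{Lip}(f^{-1})\}$; $f$ is $L$-bilipschitz if $\operatorname{bilip}(f)\le L$ and bilipschitz if this holds for some finite $L$. Definition of $\beta_d$: let $\mathcal{F}_d$ be the collection of all monotone increasing functions $\psi\colon[1,\infty)\to[1,\infty)$ such that the following holds: for every $S\in\mathbb{N}$, with $Q:=(-\frac12,\dots,-\frac12)+[0,S]^{d-1}\subseteq\mathbb{R}^{d-1}$, and every permutation $\sigma\colon\mathbb{Z}^{d-1}\to\mathbb{Z}^{d-1}$ such that for each $z\in\mathbb{Z}^{d-1}$ the restriction of $\sigma$ to $\mathbb{Z}^{d-1}\cap(Q+Sz)$ is a permutation of $\mathbb{Z}^{d-1}\cap(Q+Sz)$, there is a $\psi(S)$-bilipschitz mapping $\Upsilon\colon\mathbb{R}^d\to\mathbb{R}^d$ with $\Upsilon(x)=x$ for all $x\in\mathbb{R}^{d-1}\times(\mathbb{R}\setminus(-\frac12,\frac12))$ and $\Upsilon(x,0)=(\sigma(x),0)$ for all $x\in\mathbb{Z}^{d-1}$. Then $\beta_d$ is the pointwise infimum of $\mathcal{F}_d$. *)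

theory Defs
  imports "HOL-Analysis.Analysis"
begin

text \<open>Convention: R^d is modelled as real^'m \<times> real with d = CARD('m) + 1
  (the last coordinate is the second component; the product norm is Euclidean).
  Thus d \<ge> 2 automatically.\<close>

definition int_vecs :: "(real^'m) set" where
  "int_vecs = {z. \<forall>i. z $ i \<in> \<int>}"

definition int_pts :: "((real^'m) \<times> real) set" where
  "int_pts = {x. fst x \<in> int_vecs \<and> snd x \<in> \<int>}"

definition bilip_on :: "real \<Rightarrow> 'a::metric_space set \<Rightarrow> ('a \<Rightarrow> 'b::metric_space) \<Rightarrow> bool" where
  "bilip_on L S f \<longleftrightarrow> inj_on f S \<and>
     (\<forall>x\<in>S. \<forall>y\<in>S. dist (f x) (f y) \<le> L * dist x y \<and> dist x y \<le> L * dist (f x) (f y))"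

definition bilipschitz_on :: "'a::metric_space set \<Rightarrow> ('a \<Rightarrow> 'b::metric_space) \<Rightarrow> bool" where
  "bilipschitz_on S f \<longleftrightarrow> (\<exists>L. bilip_on L S f)"

definition layers :: "nat \<Rightarrow> ((real^'m) \<times> real) set" where
  "layers T = {x. \<exists>k::int. snd x = real_of_int k * real T + 1/2}"

definition slab :: "nat \<Rightarrow> int \<Rightarrow> ((real^'m) \<times> real) set" where
  "slab T k = {x. real_of_int (k - 1) * real T + 1/2 \<le> snd x \<and> snd x \<le> real_of_int k * real T + 1/2}"

definition cube_shift :: "nat \<Rightarrow> real^'m \<Rightarrow> (real^'m) set" where
  "cube_shift S z = {y. \<forall>i. real S * z $ i - 1/2 \<le> y $ i \<and> y $ i \<le> real S * z $ i + real S - 1/2}"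

definition psi_class :: "'m::finite itself \<Rightarrow> (real \<Rightarrow> real) set" where
  "psi_class _ = {\<psi>. mono_on {1..} \<psi> \<and> (\<forall>t\<ge>1. \<psi> t \<ge> 1) \<and>
     (\<forall>S::nat. S \<ge> 1 \<longrightarrow>
       (\<forall>\<sigma> :: real^'m \<Rightarrow> real^'m.
          bij_betw \<sigma> int_vecs int_vecs \<and>
          (\<forall>z\<in>int_vecs. bij_betw \<sigma> (int_vecs \<inter> cube_shift S z) (int_vecs \<inter> cube_shift S z))
          \<longrightarrow> (\<exists>\<Upsilon> :: (real^'m) \<times> real \<Rightarrow> (real^'m) \<times> real.
                 bilip_on (\<psi> (real S)) UNIV \<Upsilon> \<and>
                 (\<forall>x. \<bar>snd x\<bar> \<ge> 1/2 \<longrightarrow> \<Upsilon> x = x) \<and>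
                 (\<forall>x\<in>int_vecs. \<Upsilon> (x, 0) = (\<sigma> x, 0)))))}"

definition beta :: "'m::finite itself \<Rightarrow> real \<Rightarrow> real" where
  "beta m t = Inf ((\<lambda>\<psi>. \<psi> t) ` psi_class m)"

end

theory Submission
  imports Defs
begin

text \<open>
  Given (ii), the map \<open>g = G\<inverse> \<circ> f\<close> on the integer lattice has bounded displacement, because
  every lattice point is close to a layer, and the combined map of (ii)
  followed by \<open>G\<inverse>\<close> fixes the layers; its values are separated.
  It therefore suffices to extend a separated map of bounded displacement. Points can be moved
  simultaneously along prescribed vectors, by one bilipschitz map, as long as they are far apart
  relative to these vectors in some seminorm. Four such moves suffice: lift
  points of the same height by amounts depending on their residues, so that nearby points get
  different heights; move horizontally to a generic position near the target; move
  vertically to the height of the target; correct the small remaining error. This gives a bound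
  polynomial in \<open>M\<^sub>1 M\<^sub>2 T\<close>, which lies below the claimed one already because
  \<open>2 \<lfloor>t\<rfloor> - 1 \<le> \<beta>(t)\<close>. The same moves realise the permutations
  in the definition of \<open>\<beta>\<close> with a constant polynomial in \<open>S\<close>.
\<close>

section \<open>Elementary rules for bilipschitz bounds\<close>

lemma bilip_onI:
  assumes "\<And>x y. x \<in> S \<Longrightarrow> y \<in> S \<Longrightarrow> dist (f x) (f y) \<le> L * dist x y"
    and "\<And>x y. x \<in> S \<Longrightarrow> y \<in> S \<Longrightarrow> dist x y \<le> L * dist (f x) (f y)"
  shows "bilip_on L S f"
proof -
  have "inj_on f S"
  proof (rule inj_onI)
    fix x y assume "x \<in> S" "y \<in> S" "f x = f y"
    with assms(2)[of x y] show "x = y" by simp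
  qed
  then show ?thesis using assms by (auto simp: bilip_on_def)
qed

lemma bilip_on_mono:
  assumes "bilip_on L S f" "L \<le> L'"
  shows "bilip_on L' S f"
proof (rule bilip_onI)
  fix x y assume xy: "x \<in> S" "y \<in> S"
  have "L * r \<le> L' * r" if "0 \<le> r" for r using assms(2) that by (rule mult_right_mono)
  then show "dist (f x) (f y) \<le> L' * dist x y" "dist x y \<le> L' * dist (f x) (f y)"
    using assms(1) xy unfolding bilip_on_def by (meson order_trans zero_le_dist)+
qed

lemma bilip_on_ge_1:
  assumes "bilip_on L S f" "x \<in> S" "y \<in> S" "x \<noteq> y"
  shows "1 \<le> L"
proof (rule ccontr)
  assume "\<not> 1 \<le> L"
  have le: "dist (f x) (f y) \<le> L * dist x y" "dist x y \<le> L * dist (f x) (f y)"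
    using assms by (auto simp: bilip_on_def)
  have pos: "dist x y > 0" using assms by simp
  have "dist (f x) (f y) > 0"
    using assms by (auto simp: bilip_on_def inj_on_def)
  then have "L * dist (f x) (f y) < dist (f x) (f y)" "L * dist x y < dist x y"
    using \<open>\<not> 1 \<le> L\<close> pos by auto
  with le show False by linarith
qed

lemma bilip_on_comp:
  assumes f: "bilip_on L UNIV f" and g: "bilip_on L' UNIV g" and "0 \<le> L" "0 \<le> L'"
  shows "bilip_on (L' * L) UNIV (g \<circ> f)"
proof (rule bilip_onI)
  fix x y
  have "dist (g (f x)) (g (f y)) \<le> L' * dist (f x) (f y)" using g by (simp add: bilip_on_def)
  also have "\<dots> \<le> L' * (L * dist x y)"
    using f \<open>0 \<le> L'\<close> by (intro mult_left_mono) (auto simp: bilip_on_def)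
  finally show "dist ((g \<circ> f) x) ((g \<circ> f) y) \<le> L' * L * dist x y" by (simp add: mult.assoc)
  have "dist x y \<le> L * dist (f x) (f y)" using f by (simp add: bilip_on_def)
  also have "\<dots> \<le> L * (L' * dist (g (f x)) (g (f y)))"
    using g \<open>0 \<le> L\<close> by (intro mult_left_mono) (auto simp: bilip_on_def)
  finally show "dist x y \<le> L' * L * dist ((g \<circ> f) x) ((g \<circ> f) y)" by (simp add: ac_simps)
qed

section \<open>Moving many separated points with one bilipschitz map\<close>

text \<open>The amount \<open>g\<close> of the move varies along the direction \<open>W\<close> at
  rate at most 1/2. Hence the difference \<open>r\<close> of two amounts obeys
  \<open>\<bar>r\<bar> \<le> \<bar>r\<bar> / 2 + K * norm d\<close>, where \<open>d\<close> is the
  difference of the images, and absorbing the first term controls \<open>r\<close> from the images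
  alone. No smallness of \<open>K * B\<close> is required.\<close>

lemma bilip_on_push:
  fixes g :: "'a::real_normed_vector \<Rightarrow> real"
  assumes lip: "\<And>X Y. \<bar>g X - g Y\<bar> \<le> K * norm (X - Y)"
    and dir: "\<And>X s. \<bar>g (X + s *\<^sub>R W) - g X\<bar> \<le> \<bar>s\<bar> / 2"
    and W: "norm W \<le> B" and K: "0 \<le> K"
  shows "bilip_on (1 + 2 * K * B) UNIV (\<lambda>X. X + g X *\<^sub>R W)"
proof (rule bilip_onI)
  fix X Y :: 'a
  define r where "r = g X - g Y"
  define d where "d = (X + g X *\<^sub>R W) - (Y + g Y *\<^sub>R W)"
  have B: "0 \<le> B" using W norm_ge_zero[of W] by linarith
  have d: "d = (X - Y) + r *\<^sub>R W" by (simp add: d_def r_def algebra_simps)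
  have rW: "norm (r *\<^sub>R W) \<le> \<bar>r\<bar> * B" using W by (simp add: mult_left_mono)
  have "norm d \<le> norm (X - Y) + norm (r *\<^sub>R W)" unfolding d by (rule norm_triangle_ineq)
  also have "\<dots> \<le> norm (X - Y) + K * norm (X - Y) * B"
    using rW mult_right_mono[OF lip[of X Y] B] by (simp add: r_def)
  also have "\<dots> \<le> (1 + 2 * K * B) * norm (X - Y)"
    using K B by (simp add: algebra_simps)
  finally show "dist (X + g X *\<^sub>R W) (Y + g Y *\<^sub>R W) \<le> (1 + 2 * K * B) * dist X Y"
    by (simp add: dist_norm d_def)
  \<comment> \<open>\<open>X\<close> differs from \<open>Y + d\<close> only along \<open>W\<close>,
    so passing through \<open>Y + d\<close> splits \<open>g X - g Y\<close> into a part handled by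
    \<open>dir\<close> and a part handled by \<open>lip\<close>.\<close>
  have XY: "X = (Y + d) + (- r) *\<^sub>R W" by (simp add: d)
  have "\<bar>r\<bar> \<le> \<bar>g X - g (Y + d)\<bar> + \<bar>g (Y + d) - g Y\<bar>" unfolding r_def by linarith
  also have "\<dots> = \<bar>g ((Y + d) + (- r) *\<^sub>R W) - g (Y + d)\<bar> + \<bar>g (Y + d) - g Y\<bar>"
    using arg_cong[OF XY, of g] by simp
  also have "\<dots> \<le> \<bar>r\<bar> / 2 + K * norm d" using dir[of "Y + d" "- r"] lip[of "Y + d" Y] by simp
  finally have r: "\<bar>r\<bar> \<le> 2 * K * norm d" by simp
  have "norm (X - Y) \<le> norm d + norm (r *\<^sub>R W)"
    using norm_triangle_ineq4[of d "r *\<^sub>R W"] by (simp add: d)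
  also have "\<dots> \<le> norm d + 2 * K * norm d * B"
    using rW mult_right_mono[OF r B] by simp
  also have "\<dots> = (1 + 2 * K * B) * norm d" by (simp add: algebra_simps)
  finally show "dist X Y \<le> (1 + 2 * K * B) * dist (X + g X *\<^sub>R W) (Y + g Y *\<^sub>R W)"
    by (simp add: dist_norm d_def)
qed

text \<open>Only two points in different supports \<open>U i\<close> and \<open>U j\<close> need an
  argument. There \<open>h i\<close> fixes \<open>Y\<close> and \<open>h j\<close> fixes
  \<open>X\<close>, so the distance of the images splits into two distances controlled by a single
  map each and one original distance.\<close>

lemma bilip_on_glue:
  fixes h :: "'i \<Rightarrow> 'a::metric_space \<Rightarrow> 'a"
  assumes bl: "\<And>i. i \<in> I \<Longrightarrow> bilip_on L UNIV (h i)" and L: "1 \<le> L"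
    and id: "\<And>i X. i \<in> I \<Longrightarrow> X \<notin> U i \<Longrightarrow> h i X = X"
    and disj: "\<And>i j X. i \<in> I \<Longrightarrow> j \<in> I \<Longrightarrow> X \<in> U i \<Longrightarrow> X \<in> U j \<Longrightarrow> i = j"
    and H: "\<And>i X. i \<in> I \<Longrightarrow> X \<in> U i \<Longrightarrow> H X = h i X"
    and Hid: "\<And>X. (\<And>i. i \<in> I \<Longrightarrow> X \<notin> U i) \<Longrightarrow> H X = X"
  shows "bilip_on (2 * L + 1) UNIV H"
proof -
  \<comment> \<open>A value outside \<open>U i\<close> would be a fixed point of \<open>h i\<close>
    with the second preimage \<open>X\<close>, against injectivity.\<close>
  have inv: "h i X \<in> U i" if "i \<in> I" "X \<in> U i" for i X
  proof (rule ccontr)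
    assume "h i X \<notin> U i"
    with id that have "h i (h i X) = h i X" by blast
    then have "h i X = X" using bl[OF that(1)] by (simp add: bilip_on_def inj_def)
    with \<open>h i X \<notin> U i\<close> that show False by simp
  qed
  have b1: "dist (h i X) (h i Y) \<le> L * dist X Y" "dist X Y \<le> L * dist (h i X) (h i Y)"
    if "i \<in> I" for i X Y using bl[OF that] by (auto simp: bilip_on_def)
  have weak: "L * dist X Y \<le> (2 * L + 1) * dist X Y" "dist X Y \<le> (2 * L + 1) * dist X Y" for X Y :: 'a
    using L mult_right_mono[of 1 "2 * L + 1" "dist X Y"] by (auto intro!: mult_right_mono)
  have half: "dist (H X) (H Y) \<le> (2 * L + 1) * dist X Y \<and> dist X Y \<le> (2 * L + 1) * dist (H X) (H Y)"
    if i: "i \<in> I" "X \<in> U i" for i X Y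
  proof (cases "\<exists>j\<in>I. j \<noteq> i \<and> Y \<in> U j")
    case False
    then have "H Y = h i Y" using i H[of i Y] Hid[of Y] id[of i Y] by (cases "Y \<in> U i") fastforce+
    then show ?thesis
      using H[OF i] b1[OF i(1), of X Y] weak(1)[of X Y] weak(1)[of "h i X" "h i Y"] by simp
  next
    case True
    then obtain j where j: "j \<in> I" "j \<noteq> i" "Y \<in> U j" by blast
    have HX: "H X = h i X" and HY: "H Y = h j Y" using H i j by auto
    have Y: "h i Y = Y" "h j X = X" "h i (h j Y) = h j Y" "h j (h i X) = h i X"
      using id[OF i(1)] id[OF j(1)] disj[OF i(1) j(1)] inv[OF i] inv[OF j(1,3)] i(2) j(2,3) by blast+
    have "dist (H X) (H Y) \<le> dist (h i X) (h i Y) + dist Y X + dist (h j X) (h j Y)"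
      using dist_triangle[of "h i X" "h j Y" Y] dist_triangle[of Y "h j Y" X]
      unfolding HX HY Y by linarith
    also have "\<dots> \<le> (2 * L + 1) * dist X Y"
      using b1(1)[OF i(1), of X Y] b1(1)[OF j(1), of X Y] by (simp add: algebra_simps dist_commute)
    finally have 1: "dist (H X) (H Y) \<le> (2 * L + 1) * dist X Y" .
    \<comment> \<open>The mixed distances are controlled because \<open>h i\<close> fixes
      \<open>h j Y\<close> and \<open>h j\<close> fixes \<open>h i X\<close>: both are compared with
      the distance of the two images.\<close>
    have "dist X Y \<le> dist X (h j Y) + dist (h j Y) (h i X) + dist (h i X) Y"
      using dist_triangle[of X Y "h j Y"] dist_triangle[of "h j Y" Y "h i X"] by simp
    also have "\<dots> \<le> (2 * L + 1) * dist (H X) (H Y)"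
      using b1(2)[OF i(1), of X "h j Y"] b1(2)[OF j(1), of "h i X" Y]
      unfolding Y HX HY by (simp add: algebra_simps dist_commute)
    finally show ?thesis using 1 by blast
  qed
  show ?thesis
  proof (rule bilip_onI)
    fix X Y
    have "dist (H X) (H Y) \<le> (2 * L + 1) * dist X Y \<and> dist X Y \<le> (2 * L + 1) * dist (H X) (H Y)"
    proof (cases "(\<exists>i\<in>I. X \<in> U i) \<or> (\<exists>i\<in>I. Y \<in> U i)")
      case True
      then show ?thesis using half[of _ X Y] half[of _ Y X] by (metis dist_commute)
    next
      case False
      then have "H X = X" "H Y = Y" using Hid by blast+
      then show ?thesis using weak(2)[of X Y] by simp
    qed
    then show "dist (H X) (H Y) \<le> (2 * L + 1) * dist X Y" "dist X Y \<le> (2 * L + 1) * dist (H X) (H Y)"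
      by blast+
  qed
qed

text \<open>Each point is moved with the tent function \<open>max 0 (1 - \<nu> (X - a i))\<close> as
  amount. Separation 2 makes the open unit \<nu>-balls disjoint, and \<open>short\<close> gives the
  rate 1/2 asked for by \<open>bilip_on_push\<close>. The gain is in the choice of \<nu>: a vector
  may be far longer than the Euclidean distances between the points if \<nu> gives its direction
  little weight.\<close>

lemma push_points:
  fixes \<nu> :: "'a::real_normed_vector \<Rightarrow> real"
  assumes tri: "\<And>X Y. \<nu> (X + Y) \<le> \<nu> X + \<nu> Y"
    and scale: "\<And>c X. \<nu> (c *\<^sub>R X) = \<bar>c\<bar> * \<nu> X"
    and bound: "\<And>X. \<nu> X \<le> K * norm X" and K: "0 \<le> K" and B: "0 \<le> B"
    and sep: "\<And>i j. i \<in> I \<Longrightarrow> j \<in> I \<Longrightarrow> i \<noteq> j \<Longrightarrow> 2 \<le> \<nu> (a i - a j)"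
    and short: "\<And>i. i \<in> I \<Longrightarrow> \<nu> (b i - a i) \<le> 1/2"
    and normB: "\<And>i. i \<in> I \<Longrightarrow> norm (b i - a i) \<le> B"
  shows "\<exists>H. bilip_on (3 + 4 * K * B) UNIV H \<and> (\<forall>i\<in>I. H (a i) = b i) \<and>
    (\<forall>X. (\<forall>i\<in>I. 1 \<le> \<nu> (X - a i)) \<longrightarrow> H X = X)"
proof -
  define U where "U i = {X. \<nu> (X - a i) < 1}" for i
  define g where "g i X = max 0 (1 - \<nu> (X - a i))" for i X
  define h where "h i X = X + g i X *\<^sub>R (b i - a i)" for i X
  \<comment> \<open>The supports are disjoint, so \<open>SOME\<close> has exactly one
    candidate.\<close>
  define H where "H X = (if \<exists>i\<in>I. X \<in> U i then h (SOME i. i \<in> I \<and> X \<in> U i) X else X)" for X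
  have neg: "\<nu> (- X) = \<nu> X" for X using scale[of "-1" X] by simp
  have diff: "\<bar>\<nu> X - \<nu> Y\<bar> \<le> \<nu> (X - Y)" for X Y
    using tri[of "X - Y" Y] tri[of "Y - X" X] neg[of "X - Y"] by simp
  have g_diff: "\<bar>g i X - g i Y\<bar> \<le> \<nu> (X - Y)" for i X Y
    using diff[of "X - a i" "Y - a i"] by (auto simp: g_def)
  have nu0: "\<nu> 0 = 0" using scale[of 0 0] by simp
  have disj: "i = j" if "i \<in> I" "j \<in> I" "X \<in> U i" "X \<in> U j" for i j X
  proof (rule ccontr)
    assume "i \<noteq> j"
    then show False
      using tri[of "X - a j" "a i - X"] neg[of "X - a i"] sep[OF that(1,2)] that(3,4) by (simp add: U_def)
  qed
  have hbl: "bilip_on (1 + 2 * K * B) UNIV (h i)" if "i \<in> I" for i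
    unfolding h_def
  proof (rule bilip_on_push)
    show "\<bar>g i X - g i Y\<bar> \<le> K * norm (X - Y)" for X Y
      using g_diff[of i X Y] bound[of "X - Y"] by linarith
    show "\<bar>g i (X + s *\<^sub>R (b i - a i)) - g i X\<bar> \<le> \<bar>s\<bar> / 2" for X s
      using g_diff[of i "X + s *\<^sub>R (b i - a i)" X] scale[of s "b i - a i"]
        mult_left_mono[OF short[OF that], of "\<bar>s\<bar>"] by simp
  qed (use normB that K in auto)
  have HU: "H X = h i X" if "i \<in> I" "X \<in> U i" for i X
  proof -
    have "(SOME i. i \<in> I \<and> X \<in> U i) = i" using that disj by (intro some_equality) blast+
    then show ?thesis using that by (auto simp: H_def)
  qed
  have "bilip_on (2 * (1 + 2 * K * B) + 1) UNIV H"
  proof (rule bilip_on_glue[OF hbl])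
    show "h i X = X" if "X \<notin> U i" for i X using that by (simp add: U_def h_def g_def)
    show "H X = X" if "\<And>i. i \<in> I \<Longrightarrow> X \<notin> U i" for X using that by (auto simp: H_def)
    show "1 \<le> 1 + 2 * K * B" using K B by simp
  qed (simp, rule disj, assumption+, rule HU)
  then have "bilip_on (3 + 4 * K * B) UNIV H" by (simp add: algebra_simps)
  moreover have "H (a i) = b i" if "i \<in> I" for i
    using HU[OF that, of "a i"] by (simp add: U_def h_def g_def nu0)
  moreover have "H X = X" if "\<forall>i\<in>I. 1 \<le> \<nu> (X - a i)" for X
    using that by (force simp: H_def U_def)
  ultimately show ?thesis by blast
qed

section \<open>Seminorms with separate horizontal and vertical weights\<close>

text \<open>The balls are double pyramids over cubes. Small \<alpha> and large \<gamma> make them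
  flat, which suits long horizontal moves at distinct heights; the opposite choice makes them thin,
  which suits long vertical moves.\<close>

definition cyl :: "real \<Rightarrow> real \<Rightarrow> (real^'m) \<times> real \<Rightarrow> real" where
  "cyl \<alpha> \<gamma> X = \<alpha> * infnorm (fst X) + \<gamma> * \<bar>snd X\<bar>"

lemma infnorm_ge_component_cart: "\<bar>x $ i\<bar> \<le> infnorm (x :: real^'m)"
  by (rule component_le_infnorm_cart)

lemma cyl_push_points:
  fixes a b :: "'i \<Rightarrow> (real^'m) \<times> real"
  assumes pos: "0 \<le> \<alpha>" "0 \<le> \<gamma>" "0 \<le> B"
    and sep: "\<And>i j. i \<in> I \<Longrightarrow> j \<in> I \<Longrightarrow> i \<noteq> j \<Longrightarrow> 2 \<le> cyl \<alpha> \<gamma> (a i - a j)"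
    and short: "\<And>i. i \<in> I \<Longrightarrow> cyl \<alpha> \<gamma> (b i - a i) \<le> 1/2"
    and normB: "\<And>i. i \<in> I \<Longrightarrow> norm (b i - a i) \<le> B"
  shows "\<exists>H. bilip_on (3 + 4 * (\<alpha> + \<gamma>) * B) UNIV H \<and> (\<forall>i\<in>I. H (a i) = b i) \<and>
    (\<forall>X. (\<forall>i\<in>I. 1 \<le> cyl \<alpha> \<gamma> (X - a i)) \<longrightarrow> H X = X)"
proof -
  have tri: "cyl \<alpha> \<gamma> (X + Y) \<le> cyl \<alpha> \<gamma> X + cyl \<alpha> \<gamma> Y" for X Y :: "(real^'m) \<times> real"
    using mult_left_mono[OF infnorm_triangle[of "fst X" "fst Y"] pos(1)]
      mult_left_mono[OF abs_triangle_ineq[of "snd X" "snd Y"] pos(2)]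
    by (simp add: cyl_def algebra_simps)
  have scale: "cyl \<alpha> \<gamma> (c *\<^sub>R X) = \<bar>c\<bar> * cyl \<alpha> \<gamma> X" for c and X :: "(real^'m) \<times> real"
    by (simp add: cyl_def infnorm_mul abs_mult algebra_simps)
  have bound: "cyl \<alpha> \<gamma> X \<le> (\<alpha> + \<gamma>) * norm X" for X :: "(real^'m) \<times> real"
  proof -
    have "infnorm (fst X) \<le> norm X"
      using infnorm_le_norm[of "fst X"] norm_fst_le[of "fst X" "snd X"] by simp
    moreover have "\<bar>snd X\<bar> \<le> norm X" using norm_snd_le[of "snd X" "fst X"] by simp
    ultimately show ?thesis
      using pos by (auto simp: cyl_def distrib_right intro!: add_mono mult_left_mono)
  qed
  have "0 \<le> \<alpha> + \<gamma>" using pos by simp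
  from push_points[where \<nu> = "cyl \<alpha> \<gamma>" and I = I and a = a and b = b,
      OF tri scale bound this pos(3) sep short normB]
  show ?thesis by simp
qed

section \<open>Residue labels of lattice points\<close>

text \<open>The label enumerates the vectors of residues modulo \<open>N\<close>. Distinct lattice
  points are then either told apart by their labels or at least \<open>N\<close> apart in some
  coordinate.\<close>

lemma residue_label:
  fixes N :: nat
  assumes "0 < N"
  obtains l :: "real^'m \<Rightarrow> nat" where "\<And>x. l x < N ^ CARD('m)"
    "\<And>x y. l x = l y \<Longrightarrow> \<forall>i. \<lfloor>x $ i\<rfloor> mod int N = \<lfloor>y $ i\<rfloor> mod int N"
proof -
  define F where "F = (PiE (UNIV :: 'm set) (\<lambda>_. {0..<int N}))"
  have F: "finite F" "card F = N ^ CARD('m)" by (auto simp: F_def finite_PiE card_PiE)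
  from ex_bij_betw_finite_nat[OF F(1)] obtain e where e: "bij_betw e F {0..<card F}" by blast
  define r where "r x = (\<lambda>i. \<lfloor>(x :: real^'m) $ i\<rfloor> mod int N)" for x
  have r: "r x \<in> F" for x using assms by (auto simp: r_def F_def)
  show ?thesis
  proof
    show "e (r x) < N ^ CARD('m)" for x using bij_betwE[OF e] r F(2) by auto
    show "\<forall>i. \<lfloor>x $ i\<rfloor> mod int N = \<lfloor>y $ i\<rfloor> mod int N" if "e (r x) = e (r y)" for x y
    proof -
      have "r x = r y" using e r that by (meson bij_betw_def inj_onD)
      then show ?thesis by (simp add: r_def fun_eq_iff)
    qed
  qed
qed

lemma abs_diff_ge_1_Ints: "x \<in> \<int> \<Longrightarrow> y \<in> \<int> \<Longrightarrow> x \<noteq> y \<Longrightarrow> 1 \<le> \<bar>x - (y :: real)\<bar>"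
  by (rule Ints_nonzero_abs_ge1) auto

lemma abs_diff_ge_mod:
  fixes x y :: real
  assumes "x \<in> \<int>" "y \<in> \<int>" "\<lfloor>x\<rfloor> mod int N = \<lfloor>y\<rfloor> mod int N" "x \<noteq> y"
  shows "real N \<le> \<bar>x - y\<bar>"
proof -
  have "int N dvd \<lfloor>x\<rfloor> - \<lfloor>y\<rfloor>" using assms(3) by (simp add: mod_eq_dvd_iff)
  moreover have "\<lfloor>x\<rfloor> - \<lfloor>y\<rfloor> \<noteq> 0" using assms by (auto elim!: Ints_cases)
  ultimately have "int N \<le> \<bar>\<lfloor>x\<rfloor> - \<lfloor>y\<rfloor>\<bar>" using dvd_imp_le_int[of "\<lfloor>x\<rfloor> - \<lfloor>y\<rfloor>" "int N"] by simp
  then have "real_of_int (int N) \<le> real_of_int \<bar>\<lfloor>x\<rfloor> - \<lfloor>y\<rfloor>\<bar>" by linarith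
  then show ?thesis using assms(1,2) by (auto elim!: Ints_cases)
qed

text \<open>Multiplication by \<open>Q\<close> turns the expression into an integer, which is
  nonzero because \<open>l\<close> and \<open>l'\<close> are different residues modulo
  \<open>Q\<close>.\<close>

lemma label_gap:
  fixes m :: real and l l' Q :: nat
  assumes "m \<in> \<int>" "l < Q" "l' < Q" "l \<noteq> l'"
  shows "1 / real Q \<le> \<bar>m + real l / real Q - real l' / real Q\<bar>"
proof -
  obtain k where k: "m = of_int k" using assms(1) by (auto elim: Ints_cases)
  have Q: "real Q > 0" using assms by simp
  have "k * int Q + int l - int l' \<noteq> 0"
  proof
    assume "k * int Q + int l - int l' = 0"
    then have "int l' = int l + k * int Q" by simp
    then have "int l' mod int Q = int l mod int Q" by simp
    then show False using assms by simp
  qed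
  then have "1 \<le> \<bar>k * int Q + int l - int l'\<bar>" by linarith
  then have "1 \<le> \<bar>real_of_int (k * int Q + int l - int l')\<bar>" by linarith
  also have "real_of_int (k * int Q + int l - int l') = (m + real l / real Q - real l' / real Q) * real Q"
    using Q by (simp add: k field_simps)
  finally have "1 \<le> \<bar>m + real l / real Q - real l' / real Q\<bar> * real Q" by (simp only: abs_mult abs_of_nat)
  then show ?thesis using Q by (simp only: pos_divide_le_eq)
qed


section \<open>The lower bound for members of \<open>psi_class\<close>\<close>

lemma bij_betw_involution:
  assumes "\<And>x. x \<in> A \<Longrightarrow> s x \<in> A" "\<And>x. x \<in> A \<Longrightarrow> s (s x) = x"
  shows "bij_betw s A A"
  using assms by (intro bij_betw_byWitness[where f' = s]) auto

lemma psi_class_lower: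
  assumes psi: "\<psi> \<in> psi_class TYPE('m::finite)" and t: "1 \<le> t"
  shows "2 * of_int \<lfloor>t\<rfloor> - 1 \<le> \<psi> t"
proof -
  define S where "S = nat \<lfloor>t\<rfloor>"
  have S: "1 \<le> S" "real S = of_int \<lfloor>t\<rfloor>" "real S \<le> t" using t by (auto simp: S_def le_nat_iff)
  \<comment> \<open>An arbitrary but fixed coordinate direction.\<close>
  define k :: 'm where "k = undefined"
  \<comment> \<open>With \<open>q = j div S\<close>, this reflects the integers from
    \<open>S * q\<close> to \<open>S * q + S - 1\<close>. It keeps \<open>q\<close>, hence is an
    involution, and bijectivity on each block comes for free.\<close>
  define \<rho> where "\<rho> j = 2 * int S * (j div int S) + int S - 1 - j" for j
  define \<sigma> :: "real^'m \<Rightarrow> real^'m" where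
    "\<sigma> y = (\<chi> i. if i = k then of_int (\<rho> \<lfloor>y $ k\<rfloor>) else y $ i)" for y
  have rho: "\<rho> j = int S * (j div int S) + (int S - 1 - j mod int S)" for j
    using minus_mult_div_eq_mod[of j "int S"] by (simp add: \<rho>_def algebra_simps)
  have rho_div: "\<rho> j div int S = j div int S" for j
  proof -
    have "0 \<le> int S - 1 - j mod int S" "int S - 1 - j mod int S < int S"
      using S pos_mod_bound[of "int S" j] pos_mod_sign[of "int S" j] by linarith+
    then show ?thesis unfolding rho by simp
  qed
  have rho_rho: "\<rho> (\<rho> j) = j" for j
    unfolding \<rho>_def[of "\<rho> j"] rho_div by (simp add: \<rho>_def)
  have ints: "\<sigma> y \<in> int_vecs" if "y \<in> int_vecs" for y
    using that by (auto simp: int_vecs_def \<sigma>_def)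
  have inv: "\<sigma> (\<sigma> y) = y" if "y \<in> int_vecs" for y
    using that by (auto simp: int_vecs_def \<sigma>_def vec_eq_iff rho_rho elim!: Ints_cases)
  have block: "\<sigma> y \<in> cube_shift S z" if y: "y \<in> int_vecs" "y \<in> cube_shift S z" and z: "z \<in> int_vecs" for y z
  proof -
    obtain j where j: "y $ k = of_int j" using y by (auto simp: int_vecs_def elim: Ints_cases)
    obtain q where q: "z $ k = of_int q" using z by (auto simp: int_vecs_def elim: Ints_cases)
    have "real S * z $ k - 1/2 \<le> y $ k" "y $ k \<le> real S * z $ k + real S - 1/2"
      using y by (auto simp: cube_shift_def)
    \<comment> \<open>The faces of a block lie at half-integers, so the inequalities sharpen to
      exactly \<open>S\<close> admissible values of \<open>j\<close>, those with quotient
      \<open>q\<close>.\<close>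
    then have "of_int (int S * q) - 1/2 \<le> (of_int j :: real)" "(of_int j :: real) \<le> of_int (int S * q + int S) - 1/2"
      by (simp_all add: j q)
    then have "int S * q \<le> j" "j < int S * q + int S" by linarith+
    then have jdiv: "j div int S = q"
      by (intro int_div_pos_eq[of j "int S" q "j - int S * q"]) auto
    have "\<rho> j = 2 * int S * q + int S - 1 - j" by (simp add: \<rho>_def jdiv)
    then have "int S * q \<le> \<rho> j" "\<rho> j \<le> int S * q + int S - 1"
      using \<open>int S * q \<le> j\<close> \<open>j < int S * q + int S\<close> by (simp_all add: algebra_simps)
    then have "real_of_int (int S * q) \<le> of_int (\<rho> j)" "real_of_int (\<rho> j) \<le> of_int (int S * q + int S - 1)"
      by (simp_all only: of_int_le_iff)
    then show ?thesis using y(2) by (auto simp: cube_shift_def \<sigma>_def j q)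
  qed
  \<comment> \<open>\<open>\<sigma>\<close> reverses each block in direction \<open>k\<close>, so it sends the neighbours \<open>-1\<close> and \<open>0\<close> to \<open>-S\<close> and \<open>S - 1\<close>.\<close>
  have "bij_betw \<sigma> int_vecs int_vecs" using ints inv by (intro bij_betw_involution)
  moreover have "\<forall>z\<in>int_vecs. bij_betw \<sigma> (int_vecs \<inter> cube_shift S z) (int_vecs \<inter> cube_shift S z)"
    using ints inv block by (intro ballI bij_betw_involution) auto
  ultimately obtain \<Upsilon> :: "(real^'m) \<times> real \<Rightarrow> (real^'m) \<times> real" where Y: "bilip_on (\<psi> (real S)) UNIV \<Upsilon>"
    "\<forall>x\<in>int_vecs. \<Upsilon> (x, 0) = (\<sigma> x, 0)"
    using psi S(1) unfolding psi_class_def by blast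
  define u :: "real^'m" where "u = - axis k 1"
  have int: "0 \<in> int_vecs" "u \<in> int_vecs" by (auto simp: int_vecs_def u_def axis_def)
  have "dist (\<Upsilon> (0, 0)) (\<Upsilon> (u, 0)) \<le> \<psi> (real S) * dist (0, 0) (u, 0 :: real)"
    using Y(1) by (simp add: bilip_on_def)
  also have "dist (0, 0) (u, 0 :: real) = 1" by (simp add: dist_Pair_Pair u_def norm_axis_1)
  also have "dist (\<Upsilon> (0, 0)) (\<Upsilon> (u, 0)) = norm (\<sigma> 0 - \<sigma> u)"
    using Y(2)[rule_format, OF int(1)] Y(2)[rule_format, OF int(2)]
    by (simp only: dist_Pair_Pair) (simp add: dist_norm)
  finally have 1: "norm (\<sigma> 0 - \<sigma> u) \<le> \<psi> (real S)" by simp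
  have "\<rho> 0 = int S - 1" "\<rho> (- 1) = - int S" using S(1) by (simp_all add: \<rho>_def div_eq_minus1)
  moreover have "(\<sigma> 0 - \<sigma> u) $ k = of_int (\<rho> 0 - \<rho> (- 1))"
    using floor_of_int[of "-1", where 'a = real] by (simp add: \<sigma>_def u_def)
  ultimately have "(\<sigma> 0 - \<sigma> u) $ k = 2 * real S - 1" by simp
  then have "2 * real S - 1 \<le> norm (\<sigma> 0 - \<sigma> u)" using component_le_norm_cart[of "\<sigma> 0 - \<sigma> u" k] by simp
  also have "\<dots> \<le> \<psi> t"
  proof -
    have "\<psi> (real S) \<le> \<psi> t"
      using psi S t unfolding psi_class_def by (auto simp: mono_on_def)
    with 1 show ?thesis by linarith
  qed
  finally show ?thesis by (simp add: S)
qed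

section \<open>Realising block permutations, and the bounds on \<open>beta\<close>\<close>

text \<open>Three moves: \<open>A\<close> lifts each point to a height given by its label,
  \<open>B\<close> moves it horizontally above its target, \<open>C\<close> lowers it. Points left
  at the same height are \<open>4 * S\<close> apart, which is enough room for horizontal vectors
  with entries up to \<open>S\<close>.\<close>

lemma permutation_extension:
  fixes \<sigma> :: "real^'m \<Rightarrow> real^'m"
  assumes bij: "bij_betw \<sigma> int_vecs int_vecs" and S: "1 \<le> S"
    and disp: "\<And>x i. x \<in> int_vecs \<Longrightarrow> \<bar>\<sigma> x $ i - x $ i\<bar> \<le> real S"
  shows "\<exists>\<Upsilon>. bilip_on (640 * real CARD('m) * (4 * real S) ^ (CARD('m) + 1)) UNIV \<Upsilon> \<and>
    (\<forall>x. \<bar>snd x\<bar> \<ge> 1/2 \<longrightarrow> \<Upsilon> x = x) \<and>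
    (\<forall>x\<in>int_vecs. \<Upsilon> (x, 0 :: real) = (\<sigma> x, 0 :: real))"
proof -
  define n where "n = CARD('m)"
  define N where "N = 4 * S"
  have N: "0 < N" using S by (simp add: N_def)
  from residue_label[OF N] obtain l :: "real^'m \<Rightarrow> nat" where l: "\<And>x. l x < N ^ CARD('m)"
    "\<And>x y. l x = l y \<Longrightarrow> \<forall>i. \<lfloor>x $ i\<rfloor> mod int N = \<lfloor>y $ i\<rfloor> mod int N" by blast
  define Q where "Q = N ^ n"
  have Q: "0 < Q" "1 \<le> real Q" using N by (auto simp: Q_def)
  \<comment> \<open>Heights up to 1/8 have weighted length at most 1/2 under the vertical weight 4
    of \<open>A\<close> and \<open>C\<close>, and they keep all three moves inside the slab where
    changes are allowed.\<close>
  define \<theta> where "\<theta> x = real (l x) / real (8 * Q)" for x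
  have \<theta>: "0 \<le> \<theta> x" "\<theta> x \<le> 1/8" for x
    using l(1)[of x] Q by (auto simp: \<theta>_def Q_def n_def field_simps)
  define a where "a x = (x, 0 :: real)" for x :: "real^'m"
  define b where "b x = (x, \<theta> x)" for x :: "real^'m"
  define c where "c x = (\<sigma> x, \<theta> x)" for x :: "real^'m"
  define e where "e x = (\<sigma> x, 0 :: real)" for x :: "real^'m"
  have int_sep: "1 \<le> infnorm (x - y)" if xy: "x \<in> int_vecs" "y \<in> int_vecs" "x \<noteq> y" for x y :: "real^'m"
  proof -
    obtain i where "x $ i \<noteq> y $ i" using xy by (auto simp: vec_eq_iff)
    then have "1 \<le> \<bar>(x - y) $ i\<bar>" using xy abs_diff_ge_1_Ints by (auto simp: int_vecs_def)
    also have "\<dots> \<le> infnorm (x - y)" by (rule infnorm_ge_component_cart)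
    finally show ?thesis .
  qed
  have sig: "\<sigma> x \<in> int_vecs" if "x \<in> int_vecs" for x using bij that by (auto simp: bij_betw_def)
  have sig_inj: "\<sigma> x \<noteq> \<sigma> y" if "x \<in> int_vecs" "y \<in> int_vecs" "x \<noteq> y" for x y
    using bij that by (auto simp: bij_betw_def inj_on_def)
  have inf0: "infnorm (0 :: real^'m) = 0" by (simp add: infnorm_eq_0)
  have pos: "0 \<le> (2 :: real)" "0 \<le> (4 :: real)" "0 \<le> (1/8 :: real)" by simp_all
  have Asep: "2 \<le> cyl 2 4 (a x - a y)" if "x \<in> int_vecs" "y \<in> int_vecs" "x \<noteq> y" for x y
    using int_sep[OF that] by (simp add: a_def cyl_def)
  have Ashort: "cyl 2 4 (b x - a x) \<le> 1/2" and Anorm: "norm (b x - a x) \<le> 1/8" for x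
    using \<theta>[of x] by (simp_all add: a_def b_def cyl_def inf0 norm_Pair)
  from cyl_push_points[of 2 4 "1/8" int_vecs a b, OF pos Asep Ashort Anorm]
  obtain A where A: "bilip_on (3 + 4 * (2 + 4) * (1/8)) UNIV A" "\<And>x. x \<in> int_vecs \<Longrightarrow> A (a x) = b x"
    "\<And>X. (\<And>x. x \<in> int_vecs \<Longrightarrow> 1 \<le> cyl 2 4 (X - a x)) \<Longrightarrow> A X = X" by blast
  have Csep: "2 \<le> cyl 2 4 (c x - c y)" if "x \<in> int_vecs" "y \<in> int_vecs" "x \<noteq> y" for x y
  proof -
    have "1 \<le> infnorm (\<sigma> x - \<sigma> y)" using that sig sig_inj by (intro int_sep) auto
    moreover have "0 \<le> 4 * \<bar>\<theta> x - \<theta> y\<bar>" by simp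
    ultimately show ?thesis unfolding c_def cyl_def fst_diff snd_diff fst_conv snd_conv by linarith
  qed
  have Cshort: "cyl 2 4 (e x - c x) \<le> 1/2" and Cnorm: "norm (e x - c x) \<le> 1/8" for x
    using \<theta>[of x] by (simp_all add: e_def c_def cyl_def inf0 norm_Pair)
  from cyl_push_points[of 2 4 "1/8" int_vecs c e, OF pos Csep Cshort Cnorm]
  obtain C where C: "bilip_on (3 + 4 * (2 + 4) * (1/8)) UNIV C" "\<And>x. x \<in> int_vecs \<Longrightarrow> C (c x) = e x"
    "\<And>X. (\<And>x. x \<in> int_vecs \<Longrightarrow> 1 \<le> cyl 2 4 (X - c x)) \<Longrightarrow> C X = X" by blast
  \<comment> \<open>The weights are read off from the requirements: a displacement \<open>S\<close>
    becomes 1/2 and a distance \<open>4 * S\<close> becomes 2 under \<alpha>; a height gap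
    \<open>1 / (8 * Q)\<close> becomes 2 under \<gamma>.\<close>
  define \<alpha> where "\<alpha> = 1 / (2 * real S)"
  define \<gamma> where "\<gamma> = 16 * real Q"
  have ag: "0 \<le> \<alpha>" "\<alpha> \<le> 1" "0 \<le> \<gamma>" "0 \<le> real n * real S" using S by (auto simp: \<alpha>_def \<gamma>_def)
  have Bsep: "2 \<le> cyl \<alpha> \<gamma> (b x - b y)" if xy: "x \<in> int_vecs" "y \<in> int_vecs" "x \<noteq> y" for x y
  proof (cases "l x = l y")
    case True
    obtain i where "x $ i \<noteq> y $ i" using xy by (auto simp: vec_eq_iff)
    then have "real N \<le> \<bar>(x - y) $ i\<bar>"
      using abs_diff_ge_mod[of "x $ i" "y $ i" N] l(2)[OF True] xy by (auto simp: int_vecs_def)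
    also have "\<dots> \<le> infnorm (x - y)" by (rule infnorm_ge_component_cart)
    finally have "\<alpha> * real N \<le> \<alpha> * infnorm (x - y)" using ag by (intro mult_left_mono)
    then show ?thesis using S ag by (simp add: cyl_def b_def \<alpha>_def N_def add_increasing2)
  next
    case False
    have "1 / real (8 * Q) \<le> \<bar>0 + \<theta> x - \<theta> y\<bar>"
      unfolding \<theta>_def using l(1)[of x] l(1)[of y] False
      by (intro label_gap) (auto simp: Q_def n_def)
    then have "\<gamma> * (1 / real (8 * Q)) \<le> \<gamma> * \<bar>\<theta> x - \<theta> y\<bar>" using ag by (intro mult_left_mono) auto
    moreover have "\<gamma> * (1 / real (8 * Q)) = 2" using Q by (simp add: \<gamma>_def)
    moreover have "0 \<le> \<alpha> * infnorm (x - y)" using ag infnorm_pos_le by (intro mult_nonneg_nonneg)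
    ultimately show ?thesis by (simp add: cyl_def b_def)
  qed
  have Bshort: "cyl \<alpha> \<gamma> (c x - b x) \<le> 1/2" if "x \<in> int_vecs" for x
  proof -
    have "infnorm (\<sigma> x - x) \<le> real S"
      unfolding infnorm_cart using disp[OF that] by (intro cSup_least) auto
    then have "\<alpha> * infnorm (\<sigma> x - x) \<le> \<alpha> * real S" using ag by (intro mult_left_mono)
    then show ?thesis using S by (simp add: cyl_def b_def c_def \<alpha>_def)
  qed
  have Bnorm: "norm (c x - b x) \<le> real n * real S" if "x \<in> int_vecs" for x
  proof -
    have "norm (\<sigma> x - x) \<le> (\<Sum>i\<in>UNIV. \<bar>(\<sigma> x - x) $ i\<bar>)" by (rule norm_le_l1_cart)
    also have "\<dots> \<le> (\<Sum>i\<in>(UNIV::'m set). real S)" using disp[OF that] by (intro sum_mono) simp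
    finally show ?thesis by (simp add: b_def c_def norm_Pair n_def)
  qed
  from cyl_push_points[of \<alpha> \<gamma> "real n * real S" int_vecs b c, OF ag(1,3,4) Bsep Bshort Bnorm]
  obtain B where B: "bilip_on (3 + 4 * (\<alpha> + \<gamma>) * (real n * real S)) UNIV B" "\<And>x. x \<in> int_vecs \<Longrightarrow> B (b x) = c x"
    "\<And>X. (\<And>x. x \<in> int_vecs \<Longrightarrow> 1 \<le> cyl \<alpha> \<gamma> (X - b x)) \<Longrightarrow> B X = X" by blast
  define L where "L = 3 + 4 * (\<alpha> + \<gamma>) * (real n * real S)"
  have L0: "0 \<le> L" using ag by (simp add: L_def)
  have A6: "bilip_on 6 UNIV A" and C6: "bilip_on 6 UNIV C" using A(1) C(1) by simp_all
  have BA: "bilip_on (L * 6) UNIV (B \<circ> A)"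
    using bilip_on_comp[OF A6 B(1)[folded L_def]] L0 by simp
  have CBA: "bilip_on (6 * (L * 6)) UNIV (C \<circ> (B \<circ> A))"
    using bilip_on_comp[OF BA C6] L0 by simp
  have n: "1 \<le> real n" by (simp add: n_def Suc_leI)
  have "L \<le> 3 + 4 * (17 * real Q) * (real n * real S)"
    unfolding L_def using ag Q by (intro add_left_mono mult_right_mono mult_left_mono) (auto simp: \<gamma>_def)
  also have "3 \<le> 3 * (real Q * (real n * real S))"
  proof -
    have "1 * (1 * 1) \<le> real Q * (real n * real S)"
      using Q n S by (intro mult_mono) auto
    then show ?thesis by simp
  qed
  finally have "L \<le> 71 * (real Q * (real n * real S))" by (simp add: algebra_simps)
  moreover have "0 \<le> real Q * (real n * real S)" by simp
  \<comment> \<open>Here 36 * 71 = 2556 is rounded up to 640 * 4, so that the factor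
    \<open>4 * S\<close> joins \<open>Q = (4 * S) ^ n\<close>.\<close>
  ultimately have "6 * (L * 6) \<le> 2560 * (real Q * (real n * real S))" by linarith
  also have "\<dots> = 640 * real n * (4 * real Q * real S)" by simp
  also have "4 * real Q * real S = (4 * real S) ^ (n + 1)"
    by (simp add: Q_def N_def)
  finally have "bilip_on (640 * real CARD('m) * (4 * real S) ^ (CARD('m) + 1)) UNIV (C \<circ> (B \<circ> A))"
    using CBA bilip_on_mono unfolding n_def by blast
  \<comment> \<open>Outside the slab the vertical parts alone reach 1 in all three seminorms: they
    are at least 4 * 1/2, 16 * Q * 3/8 and 4 * 3/8.\<close>
  moreover have "(C \<circ> (B \<circ> A)) X = X" if X: "1/2 \<le> \<bar>snd X\<bar>" for X
  proof -
    have inf: "0 \<le> s * infnorm (v :: real^'m)" if "0 \<le> s" for s v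
      using that infnorm_pos_le by (intro mult_nonneg_nonneg)
    have far: "3/8 \<le> \<bar>snd X - \<theta> x\<bar>" for x using X \<theta>[of x] by linarith
    have "A X = X" using X inf[of 2] by (intro A(3)) (auto simp: cyl_def a_def intro!: add_increasing)
    moreover have "B X = X"
    proof (intro B(3))
      fix x
      have "1 * (3/8) \<le> real Q * \<bar>snd X - \<theta> x\<bar>" using far[of x] Q by (intro mult_mono) auto
      then have "1 \<le> \<gamma> * \<bar>snd X - \<theta> x\<bar>" by (simp add: \<gamma>_def)
      then show "1 \<le> cyl \<alpha> \<gamma> (X - b x)" using inf[OF ag(1)] by (auto simp: cyl_def b_def intro!: add_increasing)
    qed
    moreover have "C X = X"
    proof (intro C(3))
      fix x
      show "1 \<le> cyl 2 4 (X - c x)" using far[of x] inf[of 2 "fst X - \<sigma> x"] by (auto simp: cyl_def c_def)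
    qed
    ultimately show ?thesis by simp
  qed
  moreover have "(C \<circ> (B \<circ> A)) (x, 0) = (\<sigma> x, 0)" if "x \<in> int_vecs" for x
    using A(2)[OF that] B(2)[OF that] C(2)[OF that] by (simp add: a_def e_def)
  ultimately show ?thesis by blast
qed

text \<open>The polynomial constant is absorbed by \<open>4 * S \<le> 4 ^ S\<close> and
  \<open>640 * n \<le> 64 ^ (n + 1)\<close>; since 64 * 4 = 2^8, the exponent becomes 8 times
  dimension times \<open>S\<close>. This member also shows that the infimum defining
  \<open>beta\<close> is over a nonempty set.\<close>

lemma psi_class_exp:
  "(\<lambda>t. 2 powr (8 * real (CARD('m::finite) + 1) * t)) \<in> psi_class TYPE('m)"
proof -
  define n where "n = CARD('m)"
  have "1 \<le> n" by (simp add: n_def Suc_leI)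
  have bound: "640 * real n * (4 * real S) ^ (n + 1) \<le> 2 powr (8 * real (n + 1) * real S)" if "1 \<le> S" for S :: nat
  proof -
    have 1: "4 * real S \<le> 4 ^ S"
    proof -
      obtain k where k: "S = Suc k" using \<open>1 \<le> S\<close> by (cases S) auto
      have "Suc k \<le> 4 ^ k" by (induction k) auto
      then have "real (Suc k) \<le> real (4 ^ k)" by (rule of_nat_mono)
      then show ?thesis by (simp add: k)
    qed
    have 2: "640 * real n \<le> 64 ^ (n + 1)"
    proof -
      have "640 * n \<le> 64 ^ (n + 1)" using \<open>1 \<le> n\<close> by (induction n rule: dec_induct) auto
      then have "real (640 * n) \<le> real (64 ^ (n + 1))" by (rule of_nat_mono)
      then show ?thesis by simp
    qed
    have "640 * real n * (4 * real S) ^ (n + 1) \<le> 64 ^ (n + 1) * (4 ^ S) ^ (n + 1)"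
      using 1 2 by (intro mult_mono power_mono) auto
    also have "\<dots> \<le> (64 ^ S) ^ (n + 1) * (4 ^ S) ^ (n + 1)"
      using that by (intro mult_right_mono power_mono self_le_power) auto
    also have "\<dots> = 2 ^ (8 * (n + 1) * S)"
    proof -
      have "(64 :: real) = 2 ^ 6" "(4 :: real) = 2 ^ 2" by simp_all
      then show ?thesis by (simp only: power_mult[symmetric] power_add[symmetric]) (simp add: algebra_simps)
    qed
    also have "\<dots> = 2 powr (8 * real (n + 1) * real S)"
      by (simp add: powr_realpow[symmetric])
    finally show ?thesis .
  qed
  have ext: "\<exists>\<Upsilon> :: (real^'m) \<times> real \<Rightarrow> (real^'m) \<times> real. bilip_on (2 powr (8 * real (CARD('m) + 1) * real S)) UNIV \<Upsilon> \<and>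
      (\<forall>x. \<bar>snd x\<bar> \<ge> 1/2 \<longrightarrow> \<Upsilon> x = x) \<and> (\<forall>x\<in>int_vecs. \<Upsilon> (x, 0) = (\<sigma> x, 0))"
    if S: "1 \<le> S" and bij: "bij_betw \<sigma> int_vecs int_vecs"
      and block: "\<forall>z\<in>int_vecs. bij_betw \<sigma> (int_vecs \<inter> cube_shift S z) (int_vecs \<inter> cube_shift S z)"
    for S :: nat and \<sigma> :: "real^'m \<Rightarrow> real^'m"
  proof -
    have disp: "\<bar>\<sigma> x $ i - x $ i\<bar> \<le> real S" if "x \<in> int_vecs" for x i
    proof -
      \<comment> \<open>The index of the block containing \<open>x\<close>. Since \<sigma> preserves
        this block, whose edges have length \<open>S\<close>, no coordinate changes by more than
        \<open>S\<close>.\<close>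
      define z :: "real^'m" where "z = (\<chi> i. of_int (\<lfloor>x $ i\<rfloor> div int S))"
      have z: "z \<in> int_vecs" by (simp add: z_def int_vecs_def)
      have "x \<in> cube_shift S z"
      proof -
        have "real S * z $ i - 1/2 \<le> x $ i \<and> x $ i \<le> real S * z $ i + real S - 1/2" for i
        proof -
          obtain j where j: "x $ i = of_int j" using \<open>x \<in> int_vecs\<close> by (auto simp: int_vecs_def elim: Ints_cases)
          have "int S * (j div int S) \<le> j" "j \<le> int S * (j div int S) + int S - 1"
            using S pos_mod_bound[of "int S" j] pos_mod_sign[of "int S" j] mult_div_mod_eq[of "int S" j]
            by linarith+
          then have "real_of_int (int S * (j div int S)) \<le> of_int j"
            "real_of_int j \<le> of_int (int S * (j div int S) + int S - 1)" by (simp_all only: of_int_le_iff)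
          then show ?thesis by (simp add: j z_def)
        qed
        then show ?thesis by (simp add: cube_shift_def)
      qed
      moreover then have "\<sigma> x \<in> cube_shift S z" using block z that by (auto simp: bij_betw_def)
      ultimately have "real S * z $ i - 1/2 \<le> x $ i \<and> x $ i \<le> real S * z $ i + real S - 1/2"
        "real S * z $ i - 1/2 \<le> \<sigma> x $ i \<and> \<sigma> x $ i \<le> real S * z $ i + real S - 1/2"
        by (simp_all add: cube_shift_def)
      then show ?thesis by linarith
    qed
    obtain \<Upsilon> :: "(real^'m) \<times> real \<Rightarrow> (real^'m) \<times> real" where U: "bilip_on (640 * real CARD('m) * (4 * real S) ^ (CARD('m) + 1)) UNIV \<Upsilon>"
      "\<forall>x. \<bar>snd x\<bar> \<ge> 1/2 \<longrightarrow> \<Upsilon> x = x" "\<forall>x\<in>int_vecs. \<Upsilon> (x, 0) = (\<sigma> x, 0)"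
      using permutation_extension[OF bij S] disp by blast
    show ?thesis
      using bilip_on_mono[OF U(1) bound[OF S, unfolded n_def]] U(2,3) by (intro exI[of _ \<Upsilon>] conjI)
  qed
  have mono: "mono_on {1..} (\<lambda>t. 2 powr (8 * real (CARD('m) + 1) * t))"
    by (intro mono_onI powr_mono mult_left_mono) auto
  have "1 \<le> 2 powr (8 * real (CARD('m) + 1) * t)" if "1 \<le> t" for t
    using that by (intro ge_one_powr_ge_zero) auto
  then show ?thesis
    unfolding psi_class_def using mono ext by blast
qed

text \<open>A real \<open>Inf\<close> is informative only over a nonempty set bounded below; the
  exponential member and the bound 1 supply these two facts.\<close>

lemma
  assumes "1 \<le> t"
  shows beta_lower: "2 * of_int \<lfloor>t\<rfloor> - 1 \<le> beta TYPE('m::finite) t"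
    and beta_ge_1: "1 \<le> beta TYPE('m) t"
    and beta_upper: "beta TYPE('m) t \<le> 2 powr (8 * real (CARD('m) + 1) * t)"
proof -
  have ne: "(\<lambda>\<psi>. \<psi> t) ` psi_class TYPE('m) \<noteq> {}" using psi_class_exp by blast
  have 1: "1 \<le> \<psi> t" if "\<psi> \<in> psi_class TYPE('m)" for \<psi>
    using that assms by (auto simp: psi_class_def)
  show "2 * of_int \<lfloor>t\<rfloor> - 1 \<le> beta TYPE('m) t"
    unfolding beta_def using ne psi_class_lower[OF _ assms] by (intro cInf_greatest) auto
  show "1 \<le> beta TYPE('m) t"
    unfolding beta_def using ne 1 by (intro cInf_greatest) auto
  have "bdd_below ((\<lambda>\<psi>. \<psi> t) ` psi_class TYPE('m))" using 1 by (intro bdd_belowI[of _ 1]) auto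
  then show "beta TYPE('m) t \<le> 2 powr (8 * real (CARD('m) + 1) * t)"
    unfolding beta_def by (intro cInf_lower) (auto intro: image_eqI[OF _ psi_class_exp])
qed

lemma mono_on_beta: "mono_on {1..} (beta TYPE('m::finite))"
proof (rule mono_onI)
  fix s t :: real assume st: "s \<in> {1..}" "t \<in> {1..}" "s \<le> t"
  have le: "\<psi> s \<le> \<psi> t" if "\<psi> \<in> psi_class TYPE('m)" for \<psi>
    using that st by (auto simp: psi_class_def mono_on_def)
  show "beta TYPE('m) s \<le> beta TYPE('m) t"
    unfolding beta_def
  proof (rule cINF_mono)
    show "psi_class TYPE('m) \<noteq> {}" using psi_class_exp by blast
    show "bdd_below ((\<lambda>\<psi>. \<psi> s) ` psi_class TYPE('m))"
      using st by (intro bdd_belowI[of _ 1]) (auto simp: psi_class_def)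
  qed (use le in blast)
qed

section \<open>Extending a separated lattice map of bounded displacement\<close>

text \<open>The points travel from \<open>p\<close> through \<open>b p\<close>, \<open>c p\<close>
  and \<open>d p\<close> to \<open>g p\<close>. Each leg has its own seminorm, in which the current
  positions are 2-separated while the vectors have length at most 1/2.\<close>

lemma bounded_displacement_extension:
  fixes g :: "(real^'m) \<times> real \<Rightarrow> (real^'m) \<times> real"
  assumes M: "1 \<le> M" and D: "1 \<le> D"
    and sep: "\<And>p q. p \<in> int_pts \<Longrightarrow> q \<in> int_pts \<Longrightarrow> p \<noteq> q \<Longrightarrow> 1 / M \<le> norm (g p - g q)"
    and disp: "\<And>p. p \<in> int_pts \<Longrightarrow> norm (g p - p) \<le> D"
  shows "\<exists>H. (\<forall>p\<in>int_pts. H p = g p) \<and>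
    bilip_on (2 ^ 19 * M * D ^ 2 * (16 * D) ^ (2 * CARD('m) + 1)) UNIV H"
proof -
  define n where "n = CARD('m)"
  define k :: 'm where "k = undefined"
  \<comment> \<open>The size \<open>9 * D\<close> covers two demands: \<open>N \<ge> 8 * D\<close>
    for \<open>\<epsilon> * N \<ge> 2\<close>, and \<open>N - 4 * D \<ge> 2\<close> after two points
    have each moved horizontally by up to \<open>2 * D\<close>.\<close>
  define N where "N = nat \<lceil>9 * D\<rceil>"
  have "real N = of_int \<lceil>9 * D\<rceil>" using D by (simp add: N_def)
  then have N: "9 * D \<le> real N" "real N \<le> 10 * D"
    using D of_int_ceiling_le_add_one[of "9 * D"] le_of_int_ceiling[of "9 * D"] by linarith+
  then have N0: "0 < N" using D by (intro gr0I) auto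
  from residue_label[OF N0] obtain l :: "real^'m \<Rightarrow> nat" where l: "\<And>x. l x < N ^ CARD('m)"
    "\<And>x y. l x = l y \<Longrightarrow> \<forall>i. \<lfloor>x $ i\<rfloor> mod int N = \<lfloor>y $ i\<rfloor> mod int N" by blast
  define Q where "Q = N ^ n"
  define P where "P = N ^ (n + 1)"
  have Q0: "0 < Q" and P0: "0 < P" using N0 by (simp_all add: Q_def P_def)
  then have Q: "0 < Q" "1 \<le> real Q" and P: "0 < P" "1 \<le> real P" by simp_all
  define r where "r p = nat (\<lfloor>snd p\<rfloor> mod int N)" for p :: "(real^'m) \<times> real"
  \<comment> \<open>A base \<open>N\<close> expansion whose last digit is the residue of the height,
    so \<open>lab\<close> records the residues of all coordinates.\<close>
  define lab where "lab p = l (fst p) * N + r p" for p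
  have r: "r p < N" for p using N0 by (simp add: r_def nat_less_iff)
  have lab: "lab p < P" for p
  proof -
    have "lab p < (l (fst p) + 1) * N" using r[of p] by (simp add: lab_def)
    also have "\<dots> \<le> N ^ n * N" using l(1)[of "fst p"] by (intro mult_right_mono) (auto simp: n_def)
    finally show ?thesis by (simp add: P_def mult.commute)
  qed
  have lab_eq: "l (fst p) = l (fst q)" "\<lfloor>snd p\<rfloor> mod int N = \<lfloor>snd q\<rfloor> mod int N" if "lab p = lab q" for p q
  proof -
    have "lab p div N = lab q div N" "lab p mod N = lab q mod N" using that by simp_all
    then have "l (fst p) = l (fst q)" "r p = r q" using r[of p] r[of q] by (simp_all add: lab_def)
    then show "l (fst p) = l (fst q)" "\<lfloor>snd p\<rfloor> mod int N = \<lfloor>snd q\<rfloor> mod int N"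
      using N0 by (simp_all add: r_def nat_eq_iff2)
  qed
  \<comment> \<open>The separation \<open>1 / M\<close> equals \<open>6 * \<delta>\<close>; errors
    of \<delta> at both points leave \<open>4 * \<delta>\<close>, and the weight
    \<open>3 * M\<close> turns \<delta> into 1/2 and \<open>4 * \<delta>\<close> into 2.\<close>
  define \<delta> where "\<delta> = 1 / (6 * M)"
  have \<delta>: "0 < \<delta>" "\<delta> \<le> 1" using M by (auto simp: \<delta>_def)
  \<comment> \<open>The lift depends on the horizontal residues only, and lies between 0 and 1/4, so
    weight 2 measures it as at most 1/2.\<close>
  define \<theta> where "\<theta> p = real (l (fst p)) / real (4 * Q)" for p :: "(real^'m) \<times> real"
  have \<theta>: "0 \<le> \<theta> p" "\<theta> p \<le> 1/4" for p
    using l(1)[of "fst p"] Q by (auto simp: \<theta>_def Q_def n_def field_simps)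
  \<comment> \<open>Rounding to the grid of mesh \<open>\<delta>\<close> leaves room to encode the label in the \<open>k\<close>-th coordinate.\<close>
  define s where "s p = \<delta> * (of_int \<lfloor>fst (g p) $ k / \<delta>\<rfloor> + real (lab p) / real P)" for p
  define u where "u p = fst (g p) + (s p - fst (g p) $ k) *\<^sub>R axis k 1" for p
  have uk: "u p $ k = s p" for p by (simp add: u_def axis_def)
  have u_close: "norm (u p - fst (g p)) \<le> \<delta>" for p
  proof -
    define w where "w = fst (g p) $ k / \<delta>"
    have "0 \<le> real (lab p) / real P" "real (lab p) / real P \<le> 1" using lab[of p] by auto
    then have "\<bar>of_int \<lfloor>w\<rfloor> + real (lab p) / real P - w\<bar> \<le> 1" by linarith
    then have "\<delta> * \<bar>of_int \<lfloor>w\<rfloor> + real (lab p) / real P - w\<bar> \<le> \<delta>" using \<delta> by (simp add: mult_left_le)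
    moreover have "s p - fst (g p) $ k = \<delta> * (of_int \<lfloor>w\<rfloor> + real (lab p) / real P - w)"
      using \<delta> by (simp add: s_def w_def algebra_simps)
    ultimately have "\<bar>s p - fst (g p) $ k\<bar> \<le> \<delta>" using \<delta> by (simp add: abs_mult)
    then show ?thesis by (simp add: u_def norm_axis_1)
  qed
  have nrm: "norm (fst X) \<le> norm X" "\<bar>snd X\<bar> \<le> norm X" for X :: "(real^'m) \<times> real"
    using norm_fst_le[of "fst X" "snd X"] norm_snd_le[of "snd X" "fst X"] by simp_all
  have disp_fst: "norm (fst (g p) - fst p) \<le> D" and disp_snd: "\<bar>snd (g p) - snd p\<bar> \<le> D"
    if "p \<in> int_pts" for p
    using disp[OF that] nrm[of "g p - p"] by simp_all
  have u_disp: "norm (u p - fst p) \<le> 2 * D" if "p \<in> int_pts" for p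
    using norm_triangle_ineq[of "u p - fst (g p)" "fst (g p) - fst p"] u_close[of p] disp_fst[OF that] \<delta> D
    by simp
  define b where "b p = (fst p, snd p + \<theta> p)" for p
  define c where "c p = (u p, snd p + \<theta> p)" for p
  define d where "d p = (u p, snd (g p))" for p
  have fst_int: "fst p $ i \<in> \<int>" and snd_int: "snd p \<in> \<int>" if "p \<in> int_pts" for p :: "(real^'m) \<times> real" and i
    using that by (auto simp: int_pts_def int_vecs_def)
  have inf_nonneg: "0 \<le> t * infnorm (v :: real^'m)" if "0 \<le> t" for t v
    using that infnorm_pos_le by (intro mult_nonneg_nonneg)
  have far_fst: "real N \<le> infnorm (fst p - fst q)"
    if pq: "p \<in> int_pts" "q \<in> int_pts" "fst p \<noteq> fst q" "l (fst p) = l (fst q)" for p q :: "(real^'m) \<times> real"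
  proof -
    obtain i where i: "fst p $ i \<noteq> fst q $ i" using pq by (auto simp: vec_eq_iff)
    have "real N \<le> \<bar>fst p $ i - fst q $ i\<bar>"
      using abs_diff_ge_mod[OF fst_int[OF pq(1)] fst_int[OF pq(2)] l(2)[OF pq(4), rule_format] i] .
    then show ?thesis using infnorm_ge_component_cart[of "fst p - fst q" i] by simp
  qed

  \<comment> \<open>First move, the lift: distinct lattice points differ by at least 1 in some
    coordinate, which weight 2 turns into 2.\<close>
  have Asep: "2 \<le> cyl 2 2 (p - q)" if pq: "p \<in> int_pts" "q \<in> int_pts" "p \<noteq> q" for p q :: "(real^'m) \<times> real"
  proof (cases "snd p = snd q")
    case True
    then obtain i where i: "fst p $ i \<noteq> fst q $ i" using pq by (auto simp: vec_eq_iff prod_eq_iff)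
    have "1 \<le> \<bar>fst p $ i - fst q $ i\<bar>"
      by (rule abs_diff_ge_1_Ints[OF fst_int[OF pq(1)] fst_int[OF pq(2)] i])
    then show ?thesis using infnorm_ge_component_cart[of "fst p - fst q" i] by (simp add: cyl_def True)
  next
    case False
    have "1 \<le> \<bar>snd p - snd q\<bar>"
      by (rule abs_diff_ge_1_Ints[OF snd_int[OF pq(1)] snd_int[OF pq(2)] False])
    then show ?thesis using inf_nonneg[of 2 "fst p - fst q"] by (simp add: cyl_def)
  qed
  have Ashort: "cyl 2 2 (b p - p) \<le> 1/2" and Anorm: "norm (b p - p) \<le> 1/4" for p
    using \<theta>[of p] infnorm_0[where 'a = "real^'m"]
    by (simp_all add: b_def cyl_def norm_prod_def)
  have Apos: "0 \<le> (2 :: real)" "0 \<le> (2 :: real)" "0 \<le> (1/4 :: real)" by simp_all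
  from cyl_push_points[of 2 2 "1/4" int_pts "\<lambda>p. p" b, OF Apos Asep Ashort Anorm]
  obtain A where A: "bilip_on (3 + 4 * (2 + 2) * (1/4)) UNIV A" "\<forall>p\<in>int_pts. A p = b p" by blast

  \<comment> \<open>Second move, horizontal: \<epsilon> turns the displacement \<open>2 * D\<close>
    into 1/2 and the distance \<open>N\<close> into at least 2, while
    \<open>\<gamma> = 8 * Q\<close> turns the height gap \<open>1 / (4 * Q)\<close> into 2.\<close>
  define \<epsilon> where "\<epsilon> = 1 / (4 * D)"
  have \<epsilon>: "0 \<le> \<epsilon>" "\<epsilon> \<le> 1" "\<epsilon> * (2 * D) = 1/2" "2 \<le> \<epsilon> * real N" "0 \<le> 2 * D"
    using D N by (auto simp: \<epsilon>_def field_simps)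
  define \<gamma> where "\<gamma> = 8 * real Q"
  have \<gamma>: "0 \<le> \<gamma>" by (simp add: \<gamma>_def)
  \<comment> \<open>Points with equal horizontal label and different horizontal part are
    \<open>N\<close> apart; for all others the lifted heights differ by at least
    \<open>1 / (4 * Q)\<close>.\<close>
  have Bsep: "2 \<le> cyl \<epsilon> \<gamma> (b p - b q)" if pq: "p \<in> int_pts" "q \<in> int_pts" "p \<noteq> q" for p q
  proof (cases "l (fst p) = l (fst q) \<and> fst p \<noteq> fst q")
    case True
    then have "\<epsilon> * real N \<le> \<epsilon> * infnorm (fst p - fst q)"
      using far_fst[OF pq(1,2)] \<epsilon>(1) by (intro mult_left_mono) auto
    moreover have "0 \<le> \<gamma> * \<bar>snd (b p - b q)\<bar>" using \<gamma> by simp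
    ultimately show ?thesis using \<epsilon>(4) by (simp add: cyl_def b_def)
  next
    case False
    have "1 / real (4 * Q) \<le> \<bar>snd p - snd q + \<theta> p - \<theta> q\<bar>"
    proof (cases "l (fst p) = l (fst q)")
      case True
      with False pq have "snd p \<noteq> snd q" by (auto simp: prod_eq_iff)
      then have "1 \<le> \<bar>snd p - snd q\<bar>" using abs_diff_ge_1_Ints snd_int pq by blast
      moreover have "1 / real (4 * Q) \<le> 1" using Q by (simp add: field_simps)
      ultimately show ?thesis using True by (simp add: \<theta>_def)
    next
      case False
      have "l x < 4 * Q" for x using l(1)[of x] by (simp add: Q_def n_def)
      then show ?thesis
        unfolding \<theta>_def using False snd_int pq by (intro label_gap Ints_diff) auto
    qed
    then have "\<gamma> * (1 / real (4 * Q)) \<le> \<gamma> * \<bar>snd (b p - b q)\<bar>"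
      using \<gamma> by (intro mult_left_mono) (simp_all add: b_def algebra_simps)
    moreover have "\<gamma> * (1 / real (4 * Q)) = 2" using Q by (simp add: \<gamma>_def)
    ultimately show ?thesis using inf_nonneg[OF \<epsilon>(1), of "fst (b p - b q)"] by (simp add: cyl_def)
  qed
  have Bshort: "cyl \<epsilon> \<gamma> (c p - b p) \<le> 1/2" and Bnorm: "norm (c p - b p) \<le> 2 * D" if "p \<in> int_pts" for p
  proof -
    have "infnorm (u p - fst p) \<le> 2 * D" using u_disp[OF that] infnorm_le_norm order_trans by blast
    then have "\<epsilon> * infnorm (u p - fst p) \<le> \<epsilon> * (2 * D)" using \<epsilon>(1) by (rule mult_left_mono)
    then show "cyl \<epsilon> \<gamma> (c p - b p) \<le> 1/2" using \<epsilon>(3) by (simp add: cyl_def c_def b_def)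
    show "norm (c p - b p) \<le> 2 * D" using u_disp[OF that] by (simp add: c_def b_def norm_Pair)
  qed
  from cyl_push_points[of \<epsilon> \<gamma> "2 * D" int_pts b c, OF \<epsilon>(1) \<gamma> \<epsilon>(5) Bsep Bshort Bnorm]
  obtain B where B: "bilip_on (3 + 4 * (\<epsilon> + \<gamma>) * (2 * D)) UNIV B" "\<forall>p\<in>int_pts. B (b p) = c p" by blast

  \<comment> \<open>Third move, vertical, with the weights exchanged: \<epsilon> now measures
    heights, and \<alpha> turns the horizontal gap \<open>\<delta> / P\<close> between different
    labels into 2.\<close>
  define \<alpha> where "\<alpha> = 12 * M * real P"
  have \<alpha>: "1 \<le> \<alpha>" "0 \<le> \<alpha>"
  proof -
    have "1 * 1 \<le> M * real P" using M P by (intro mult_mono) auto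
    then show "1 \<le> \<alpha>" "0 \<le> \<alpha>" by (simp_all add: \<alpha>_def)
  qed
  have Csep: "2 \<le> cyl \<alpha> \<epsilon> (c p - c q)" if pq: "p \<in> int_pts" "q \<in> int_pts" "p \<noteq> q" for p q
  proof (cases "lab p = lab q")
    case False
    \<comment> \<open>The rounded parts differ by an integer multiple of \<delta>, so
      \<open>label_gap\<close> applies on the scale \<delta>.\<close>
    define m :: real where "m = of_int (\<lfloor>fst (g p) $ k / \<delta>\<rfloor> - \<lfloor>fst (g q) $ k / \<delta>\<rfloor>)"
    have "u p $ k - u q $ k = \<delta> * (m + real (lab p) / real P - real (lab q) / real P)"
      unfolding uk by (simp add: s_def m_def algebra_simps)
    moreover have "1 / real P \<le> \<bar>m + real (lab p) / real P - real (lab q) / real P\<bar>"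
      using lab False by (intro label_gap) (auto simp: m_def)
    then have "\<delta> * (1 / real P) \<le> \<delta> * \<bar>m + real (lab p) / real P - real (lab q) / real P\<bar>"
      using \<delta> by (intro mult_left_mono) auto
    ultimately have "\<delta> * (1 / real P) \<le> \<bar>u p $ k - u q $ k\<bar>" using \<delta> by (simp add: abs_mult)
    also have "\<dots> \<le> infnorm (u p - u q)" using infnorm_ge_component_cart[of "u p - u q" k] by simp
    finally have "\<alpha> * (\<delta> * (1 / real P)) \<le> \<alpha> * infnorm (u p - u q)" using \<alpha>(2) by (rule mult_left_mono)
    moreover have "\<alpha> * (\<delta> * (1 / real P)) = 2" using M P by (simp add: \<alpha>_def \<delta>_def)
    moreover have "0 \<le> \<epsilon> * \<bar>snd (c p - c q)\<bar>" using \<epsilon> by simp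
    ultimately show ?thesis by (simp add: cyl_def c_def)
  next
    case True
    note eq = lab_eq[OF True]
    show ?thesis
    proof (cases "snd p = snd q")
      case True
      then have "fst p \<noteq> fst q" using pq by (auto simp: prod_eq_iff)
      then have "real N \<le> infnorm (fst p - fst q)" using far_fst pq eq by blast
      also have "\<dots> \<le> infnorm (fst p - u p) + infnorm (u p - u q) + infnorm (u q - fst q)"
        using infnorm_triangle[of "fst p - u p" "u p - fst q"] infnorm_triangle[of "u p - u q" "u q - fst q"]
        by simp
      also have "infnorm (fst p - u p) \<le> 2 * D"
        using infnorm_le_norm[of "fst p - u p"] u_disp[OF pq(1)] by (simp add: norm_minus_commute)
      also have "infnorm (u q - fst q) \<le> 2 * D"
        using infnorm_le_norm[of "u q - fst q"] u_disp[OF pq(2)] by simp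
      finally have "2 \<le> infnorm (u p - u q)" using N D by simp
      then have "1 * 2 \<le> \<alpha> * infnorm (u p - u q)" using \<alpha> by (intro mult_mono) auto
      moreover have "0 \<le> \<epsilon> * \<bar>snd (c p - c q)\<bar>" using \<epsilon> by simp
      ultimately show ?thesis by (simp add: cyl_def c_def)
    next
      case False
      have "real N \<le> \<bar>snd p - snd q\<bar>"
        by (rule abs_diff_ge_mod[OF snd_int[OF pq(1)] snd_int[OF pq(2)] eq(2) False])
      \<comment> \<open>Equal labels mean equal lifts, which cancel in the difference of
        heights.\<close>
      also have "\<bar>snd p - snd q\<bar> = \<bar>snd (c p - c q)\<bar>" using eq by (simp add: c_def \<theta>_def)
      finally have "\<epsilon> * real N \<le> \<epsilon> * \<bar>snd (c p - c q)\<bar>" using \<epsilon>(1) by (rule mult_left_mono)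
      then show ?thesis using \<epsilon>(4) inf_nonneg[OF \<alpha>(2), of "fst (c p - c q)"] by (simp add: cyl_def)
    qed
  qed
  have Cshort: "cyl \<alpha> \<epsilon> (d p - c p) \<le> 1/2" and Cnorm: "norm (d p - c p) \<le> 2 * D" if "p \<in> int_pts" for p
  proof -
    have "\<bar>snd (g p) - (snd p + \<theta> p)\<bar> \<le> 2 * D" using disp_snd[OF that] \<theta>[of p] D by linarith
    moreover from this have "\<epsilon> * \<bar>snd (g p) - (snd p + \<theta> p)\<bar> \<le> \<epsilon> * (2 * D)"
      using \<epsilon>(1) by (rule mult_left_mono)
    ultimately show "cyl \<alpha> \<epsilon> (d p - c p) \<le> 1/2" "norm (d p - c p) \<le> 2 * D"
      using \<epsilon>(3) infnorm_0[where 'a = "real^'m"] by (simp_all add: cyl_def c_def d_def norm_Pair)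
  qed
  from cyl_push_points[of \<alpha> \<epsilon> "2 * D" int_pts c d, OF \<alpha>(2) \<epsilon>(1,5) Csep Cshort Cnorm]
  obtain C where C: "bilip_on (3 + 4 * (\<alpha> + \<epsilon>) * (2 * D)) UNIV C" "\<forall>p\<in>int_pts. C (c p) = d p" by blast

  \<comment> \<open>Fourth move: the remaining error is at most \<delta>, below the separation of
    the targets in every direction, so a multiple of the Euclidean norm works.\<close>
  define \<nu> :: "(real^'m) \<times> real \<Rightarrow> real" where "\<nu> X = 3 * M * norm X" for X
  have E1: "\<nu> (X + Y) \<le> \<nu> X + \<nu> Y" for X Y
    using mult_left_mono[OF norm_triangle_ineq[of X Y], of "3 * M"] M by (simp add: \<nu>_def algebra_simps)
  have E2: "\<nu> (t *\<^sub>R X) = \<bar>t\<bar> * \<nu> X" for t X by (simp add: \<nu>_def)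
  have E3: "\<nu> X \<le> 3 * M * norm X" for X by (simp add: \<nu>_def)
  have E4: "0 \<le> 3 * M" "0 \<le> \<delta>" using M \<delta> by simp_all
  have dg: "norm (g p - d p) \<le> \<delta>" for p
  proof -
    have "g p - d p = (fst (g p) - u p, 0)" by (simp add: d_def prod_eq_iff)
    then show ?thesis using u_close[of p] by (simp add: norm_Pair norm_minus_commute)
  qed
  have Msimp: "3 * M * \<delta> = 1/2" "1 / M = 6 * \<delta>" using M by (simp_all add: \<delta>_def)
  have Esep: "2 \<le> \<nu> (d p - d q)" if pq: "p \<in> int_pts" "q \<in> int_pts" "p \<noteq> q" for p q
  proof -
    have "g p - g q = (g p - d p) + (d p - d q) + (d q - g q)" by simp
    then have "norm (g p - g q) \<le> norm (g p - d p) + norm (d p - d q) + norm (d q - g q)"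
      using norm_triangle_ineq[of "(g p - d p) + (d p - d q)" "d q - g q"]
        norm_triangle_ineq[of "g p - d p" "d p - d q"] by simp
    then have "4 * \<delta> \<le> norm (d p - d q)"
      using sep[OF pq] dg[of p] dg[of q] Msimp by (simp add: norm_minus_commute)
    then have "3 * M * (4 * \<delta>) \<le> 3 * M * norm (d p - d q)" using M by (intro mult_left_mono) auto
    then show ?thesis using Msimp(1) by (simp add: \<nu>_def)
  qed
  have Eshort: "\<nu> (g p - d p) \<le> 1/2" for p
    using mult_left_mono[OF dg[of p] E4(1)] Msimp(1) by (simp add: \<nu>_def)
  from push_points[of \<nu> "3 * M" \<delta> int_pts d g, OF E1 E2 E3 E4 Esep Eshort dg]
  obtain E where E: "bilip_on (3 + 4 * (3 * M) * \<delta>) UNIV E" "\<forall>p\<in>int_pts. E (d p) = g p" by blast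

  define LB where "LB = 75 * real Q * D"
  define LC where "LC = 107 * M * real P * D"
  have LBC: "0 \<le> LB" "0 \<le> LC" using M D by (simp_all add: LB_def LC_def)
  have QD: "1 \<le> real Q * D" using mult_mono[of 1 "real Q" 1 D] Q D by simp
  have MPD: "1 \<le> M * real P * D" using mult_mono[of 1 "M * real P" 1 D] \<alpha> mult_mono[of 1 M 1 "real P"] M P D by simp
  have A7: "bilip_on 7 UNIV A" using A(1) by simp
  have E5: "bilip_on 5 UNIV E" using E(1) M by (simp add: \<delta>_def)
  have B75: "bilip_on LB UNIV B"
  proof (rule bilip_on_mono[OF B(1)])
    have "4 * (\<epsilon> + \<gamma>) * (2 * D) \<le> 4 * (9 * real Q) * (2 * D)"
      using \<epsilon> Q by (intro mult_right_mono mult_left_mono) (auto simp: \<gamma>_def)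
    then show "3 + 4 * (\<epsilon> + \<gamma>) * (2 * D) \<le> LB" using QD by (simp add: LB_def algebra_simps)
  qed
  have C107: "bilip_on LC UNIV C"
  proof (rule bilip_on_mono[OF C(1)])
    have "1 \<le> M * real P" using mult_mono[of 1 M 1 "real P"] M P by simp
    then have "4 * (\<alpha> + \<epsilon>) * (2 * D) \<le> 4 * (13 * (M * real P)) * (2 * D)"
      using \<epsilon> by (intro mult_right_mono mult_left_mono) (auto simp: \<alpha>_def)
    then show "3 + 4 * (\<alpha> + \<epsilon>) * (2 * D) \<le> LC" using MPD by (simp add: LC_def algebra_simps)
  qed
  have BA: "bilip_on (LB * 7) UNIV (B \<circ> A)" using bilip_on_comp[OF A7 B75] LBC by simp
  have CBA: "bilip_on (LC * (LB * 7)) UNIV (C \<circ> (B \<circ> A))" using bilip_on_comp[OF BA C107] LBC by simp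
  have bl: "bilip_on (5 * (LC * (LB * 7))) UNIV (E \<circ> (C \<circ> (B \<circ> A)))"
    using bilip_on_comp[OF CBA E5] LBC by simp
  have Npow: "real (N ^ (2 * n + 1)) \<le> (16 * D) ^ (2 * n + 1)"
    unfolding of_nat_power using N D by (intro power_mono) linarith+
  \<comment> \<open>The product 5 * 107 * 75 * 7 = 280875 is below 2^19, and
    \<open>N \<le> 10 * D\<close> is relaxed to \<open>16 * D\<close>; powers of two reduce the
    later comparison to exponents.\<close>
  have "5 * (LC * (LB * 7)) = 280875 * (M * D ^ 2) * real (Q * P)"
    by (simp add: LB_def LC_def power2_eq_square)
  also have "Q * P = N ^ (2 * n + 1)"
    by (simp add: Q_def P_def power_add[symmetric] mult_2 flip: power_Suc)
  also have "280875 * (M * D ^ 2) * real (N ^ (2 * n + 1)) \<le> 2 ^ 19 * (M * D ^ 2) * (16 * D) ^ (2 * n + 1)"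
    using M D by (intro mult_mono Npow) auto
  finally have "bilip_on (2 ^ 19 * M * D ^ 2 * (16 * D) ^ (2 * n + 1)) UNIV (E \<circ> (C \<circ> (B \<circ> A)))"
    using bilip_on_mono[OF bl] by (simp add: mult.assoc)
  moreover have "\<forall>p\<in>int_pts. (E \<circ> (C \<circ> (B \<circ> A))) p = g p" using A B C E by simp
  ultimately show ?thesis unfolding n_def by blast
qed

section \<open>The claimed constant and the passage from layers to an extension\<close>

text \<open>For \<open>t \<ge> 3\<close> one has \<open>2 * \<lfloor>t\<rfloor> - 1 \<ge> t\<close>,
  so \<open>beta\<close> dominates its argument, and the argument dominates the left-hand side
  factor by factor.\<close>

lemma beta_large:
  fixes M :: real
  assumes "1 \<le> M" "1 \<le> T"
  shows "2 ^ 42 * (M * real T) ^ 3 \<le> beta TYPE('m::finite)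
    (2 powr 42 * real (CARD('m) + 1) powr (9/2) * M ^ 10 * real T powr (3 + 3 / real CARD('m)))"
    (is "_ \<le> beta _ ?t")
proof -
  have MT: "1 \<le> M * real T" using mult_mono[of 1 M 1 "real T"] assms by simp
  have "2 ^ 42 * (M * real T) ^ 3 = 2 ^ 42 * 1 * M ^ 3 * real T ^ 3" by (simp add: power_mult_distrib)
  also have "\<dots> \<le> ?t"
  proof (intro mult_mono)
    show "2 ^ 42 \<le> 2 powr (42 :: real)" by (simp add: powr_numeral)
    show "1 \<le> real (CARD('m) + 1) powr (9/2)" by (intro ge_one_powr_ge_zero) auto
    show "M ^ 3 \<le> M ^ 10" using assms by (intro power_increasing) auto
    have "real T ^ 3 = real T powr 3" using assms by (simp add: powr_numeral)
    also have "\<dots> \<le> real T powr (3 + 3 / real CARD('m))" using assms by (intro powr_mono) auto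
    finally show "real T ^ 3 \<le> real T powr (3 + 3 / real CARD('m))" .
  qed (use assms in auto)
  finally have 1: "2 ^ 42 * (M * real T) ^ 3 \<le> ?t" .
  have "3 \<le> 2 ^ 42 * (M * real T) ^ 3" using one_le_power[OF MT, of 3] by simp
  with 1 have "3 \<le> ?t" by linarith
  then have "?t \<le> 2 * of_int \<lfloor>?t\<rfloor> - 1" by linarith
  also have "\<dots> \<le> beta TYPE('m) ?t" using \<open>3 \<le> ?t\<close> by (intro beta_lower) simp
  finally show ?thesis using 1 by linarith
qed

lemma extension_from_layers:
  fixes f G :: "(real^'m) \<times> real \<Rightarrow> (real^'m) \<times> real" and T :: nat
  assumes T: "1 \<le> T" and G: "bilip_on M\<^sub>2 UNIV G"
    and fG: "bilip_on M\<^sub>1 (int_pts \<union> layers T) (\<lambda>x. if x \<in> int_pts then f x else G x)"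
    and slab: "\<And>k::int. f ` (int_pts \<inter> slab T k) \<subseteq> G ` slab T k"
  shows "\<exists>F. (\<forall>x\<in>int_pts. F x = f x) \<and>
    bilip_on ((beta TYPE('m)
       (2 powr 42 * real (CARD('m) + 1) powr (9/2) * (M\<^sub>1 * M\<^sub>2) ^ 10
        * real T powr (3 + 3 / real CARD('m)))) ^ (3 ^ CARD('m) + 1)) UNIV F"
proof -
  define n where "n = CARD('m)"
  define M where "M = M\<^sub>1 * M\<^sub>2"
  define Z where "Z = M * real T"
  define \<phi> where "\<phi> x = (if x \<in> int_pts then f x else G x)" for x
  have T1: "1 \<le> real T" using T by simp
  have two: "(0, 0) \<in> (int_pts :: ((real^'m) \<times> real) set)" "(0, 1) \<in> (int_pts :: ((real^'m) \<times> real) set)"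
    by (simp_all add: int_pts_def int_vecs_def)
  have M12: "1 \<le> M\<^sub>1" "1 \<le> M\<^sub>2"
    using bilip_on_ge_1[OF fG, of "(0, 0)" "(0, 1)"] bilip_on_ge_1[OF G, of "(0, 0)" "(0, 1)"] two by simp_all
  have M: "1 \<le> M" "M\<^sub>2 \<le> M" unfolding M_def
    using mult_mono[of 1 M\<^sub>1 1 M\<^sub>2] mult_right_mono[of 1 M\<^sub>1 M\<^sub>2] M12 by simp_all
  have Z: "1 \<le> Z" "M \<le> Z" unfolding Z_def
    using mult_mono[of 1 M 1 "real T"] mult_left_mono[of 1 "real T" M] M T1 by simp_all
  have \<phi>: "dist (\<phi> x) (\<phi> y) \<le> M\<^sub>1 * dist x y" "dist x y \<le> M\<^sub>1 * dist (\<phi> x) (\<phi> y)"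
    if "x \<in> int_pts \<union> layers T" "y \<in> int_pts \<union> layers T" for x y
    using fG that unfolding bilip_on_def \<phi>_def by blast+
  have Gd: "dist x y \<le> M\<^sub>2 * dist (G x) (G y)" for x y using G unfolding bilip_on_def by blast
  have Gu: "dist (G x) (G y) \<le> M\<^sub>2 * dist x y" for x y using G unfolding bilip_on_def by blast
  \<comment> \<open>The slabs cover the space, so the inclusions put every \<open>f p\<close> in the
    range of \<open>G\<close>; this defines \<open>g\<close> as the inverse of \<open>G\<close>
    after \<open>f\<close>.\<close>
  have "\<exists>y. G y = f p" if "p \<in> int_pts" for p
  proof -
    define k where "k = \<lfloor>(snd p - 1/2) / real T\<rfloor> + 1"
    have "of_int (k - 1) \<le> (snd p - 1/2) / real T" "(snd p - 1/2) / real T \<le> of_int k"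
      unfolding k_def by linarith+
    then have "p \<in> slab T k" using T1 by (simp add: slab_def field_simps)
    then have "f p \<in> G ` slab T k" using slab[of k] that by blast
    then show ?thesis by (metis imageE)
  qed
  then obtain g where g: "\<And>p. p \<in> int_pts \<Longrightarrow> G (g p) = f p" by metis
  have sep: "1 / M \<le> norm (g p - g q)" if pq: "p \<in> int_pts" "q \<in> int_pts" "p \<noteq> q" for p q
  proof -
    have "1 \<le> dist p q"
    proof (cases "snd p = snd q")
      case True
      then obtain i where i: "fst p $ i \<noteq> fst q $ i" using pq by (auto simp: vec_eq_iff prod_eq_iff)
      then have "1 \<le> \<bar>fst p $ i - fst q $ i\<bar>"
        using pq by (intro abs_diff_ge_1_Ints) (auto simp: int_pts_def int_vecs_def)
      also have "\<dots> \<le> dist (fst p) (fst q)"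
        using component_le_norm_cart[of "fst p - fst q" i] by (simp add: dist_norm)
      also have "\<dots> \<le> dist p q" by (rule dist_fst_le)
      finally show ?thesis .
    next
      case False
      then have "1 \<le> \<bar>snd p - snd q\<bar>"
        using pq by (intro abs_diff_ge_1_Ints) (auto simp: int_pts_def)
      also have "\<dots> \<le> dist p q" using dist_snd_le[of p q] by (simp add: dist_real_def)
      finally show ?thesis .
    qed
    also have "dist p q \<le> M\<^sub>1 * dist (G (g p)) (G (g q))"
      using \<phi>(2)[of p q] pq by (simp add: \<phi>_def g)
    also have "\<dots> \<le> M\<^sub>1 * (M\<^sub>2 * dist (g p) (g q))"
      using M12 by (intro mult_left_mono Gu) simp
    finally have "1 \<le> M * norm (g p - g q)" by (simp add: M_def dist_norm mult.assoc)
    then show ?thesis using M by (simp add: pos_divide_le_eq mult.commute)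
  qed
  have disp: "norm (g p - p) \<le> 2 * Z" if p: "p \<in> int_pts" for p
  proof -
    \<comment> \<open>The point \<open>q\<close> lies on the last layer at or below
      \<open>p\<close>, on the same vertical line, hence at distance at most
      \<open>T\<close>.\<close>
    define k where "k = \<lfloor>(snd p - 1/2) / real T\<rfloor>"
    define q where "q = (fst p, of_int k * real T + 1/2)"
    have "of_int k \<le> (snd p - 1/2) / real T" "(snd p - 1/2) / real T \<le> of_int k + 1"
      unfolding k_def by linarith+
    then have "\<bar>snd p - snd q\<bar> \<le> real T" using T1 by (simp add: q_def field_simps abs_le_iff)
    then have pq: "dist p q \<le> real T"
      by (simp add: q_def dist_prod_def dist_real_def)
    have q: "q \<in> layers T" by (auto simp: q_def layers_def)
    \<comment> \<open>Layers have half-integer heights, so the case distinction in \<phi> takes the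
      branch \<open>G\<close> at \<open>q\<close>. Composing \<phi> with the inverse of
      \<open>G\<close> therefore fixes \<open>q\<close>, and \<open>g p\<close> stays within
      \<open>M * T\<close> of it.\<close>
    have "q \<notin> int_pts"
    proof
      assume "q \<in> int_pts"
      then obtain j where "of_int k * real T + 1/2 = of_int j"
        by (auto simp: int_pts_def q_def elim: Ints_cases)
      then have "real_of_int (2 * (k * int T) + 1) = of_int (2 * j)" by simp
      then have "2 * (k * int T) + 1 = 2 * j" by (simp only: of_int_eq_iff)
      then show False by presburger
    qed
    then have "\<phi> q = G q" by (simp add: \<phi>_def)
    have "dist (g p) q \<le> M\<^sub>2 * dist (\<phi> p) (\<phi> q)"
      using Gd[of "g p" q] p \<open>\<phi> q = G q\<close> by (simp add: \<phi>_def g)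
    also have "\<dots> \<le> M\<^sub>2 * (M\<^sub>1 * real T)"
    proof (rule mult_left_mono)
      have "dist (\<phi> p) (\<phi> q) \<le> M\<^sub>1 * dist p q" using \<phi>(1) p q by blast
      also have "\<dots> \<le> M\<^sub>1 * real T" using pq M12 by (intro mult_left_mono) auto
      finally show "dist (\<phi> p) (\<phi> q) \<le> M\<^sub>1 * real T" .
    qed (use M12 in simp)
    also have "\<dots> = Z" by (simp add: Z_def M_def)
    finally have "dist (g p) q \<le> Z" .
    moreover have "real T \<le> Z" using mult_right_mono[of 1 M "real T"] M T1 by (simp add: Z_def)
    moreover have "dist (g p) p \<le> dist (g p) q + dist p q" by (metis dist_commute dist_triangle)
    ultimately show ?thesis using pq by (simp add: dist_norm)
  qed
  have Z2: "1 \<le> 2 * Z" using Z by simp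
  define L where "L = 2 ^ 19 * M * (2 * Z) ^ 2 * (16 * (2 * Z)) ^ (2 * n + 1)"
  have "\<exists>H. (\<forall>p\<in>int_pts. H p = g p) \<and> bilip_on L UNIV H"
    using bounded_displacement_extension[OF M(1) Z2 sep disp] unfolding L_def n_def .
  then obtain H where H: "\<forall>p\<in>int_pts. H p = g p" "bilip_on L UNIV H" by blast
  have L0: "0 \<le> L" using M Z by (simp add: L_def)
  have GH: "bilip_on (M\<^sub>2 * L) UNIV (G \<circ> H)" using bilip_on_comp[OF H(2) G L0] M12 by simp
  define \<beta> where "\<beta> = beta TYPE('m) (2 powr 42 * real (CARD('m) + 1) powr (9/2) * M ^ 10
    * real T powr (3 + 3 / real CARD('m)))"
  have \<beta>: "2 ^ 42 * Z ^ 3 \<le> \<beta>" unfolding Z_def \<beta>_def by (rule beta_large[OF M(1) T])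
  have base: "1 \<le> 2 ^ 42 * Z ^ 3" using one_le_power[OF Z(1), of 3] by simp
  \<comment> \<open>All factors are collected as powers of 2 and \<open>Z\<close>. They fit under
    \<open>(2 ^ 42 * Z ^ 3) ^ (2 * n + 2)\<close>, and \<open>2 * n + 2 \<le> 3 ^ n + 1\<close>
    reaches the claimed exponent.\<close>
  have "M\<^sub>2 * L \<le> Z * (2 ^ 19 * Z * (2 * Z) ^ 2 * (16 * (2 * Z)) ^ (2 * n + 1))"
    unfolding L_def using M Z M12 by (intro mult_mono) auto
  also have "\<dots> = 2 ^ 21 * Z ^ 4 * (2 ^ 5 * Z) ^ (2 * n + 1)"
    by (simp add: power2_eq_square power4_eq_xxxx)
  also have "\<dots> = 2 ^ (26 + 10 * n) * Z ^ (2 * n + 5)"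
  proof -
    have "(2 ^ 5 * Z) ^ (2 * n + 1) = 2 ^ (5 * (2 * n + 1)) * Z ^ (2 * n + 1)"
      by (simp only: power_mult_distrib power_mult)
    moreover have "26 + 10 * n = 21 + 5 * (2 * n + 1)" "2 * n + 5 = 4 + (2 * n + 1)" by simp_all
    ultimately show ?thesis by (simp only: power_add mult.assoc mult.left_commute)
  qed
  also have "\<dots> \<le> 2 ^ (42 * (2 * n + 2)) * Z ^ (3 * (2 * n + 2))"
    using Z by (intro mult_mono power_increasing) auto
  also have "\<dots> = (2 ^ 42 * Z ^ 3) ^ (2 * n + 2)" by (simp only: power_mult_distrib power_mult)
  also have "\<dots> \<le> (2 ^ 42 * Z ^ 3) ^ (3 ^ n + 1)"
  proof (rule power_increasing[OF _ base])
    have "2 * n + 1 \<le> 3 ^ n" by (induction n) auto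
    then show "2 * n + 2 \<le> 3 ^ n + 1" by simp
  qed
  also have "\<dots> \<le> \<beta> ^ (3 ^ n + 1)" using \<beta> base by (intro power_mono) linarith+
  finally have "bilip_on (\<beta> ^ (3 ^ n + 1)) UNIV (G \<circ> H)" using bilip_on_mono[OF GH] by blast
  moreover have "\<forall>x\<in>int_pts. (G \<circ> H) x = f x" using H(1) g by simp
  ultimately show ?thesis unfolding \<beta>_def n_def M_def by blast
qed

theorem theorem1p2:
  fixes f :: "(real^'m) \<times> real \<Rightarrow> (real^'m) \<times> real"
  assumes f_bilip: "bilipschitz_on int_pts f"
  shows "((\<exists>F. bilipschitz_on UNIV F \<and> (\<forall>x\<in>int_pts. F x = f x)) \<longleftrightarrow>
           (\<exists>T::nat. \<exists>G. T \<ge> 1 \<and> bilipschitz_on UNIV G \<and>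
              bilipschitz_on (int_pts \<union> layers T) (\<lambda>x. if x \<in> int_pts then f x else G x) \<and>
              (\<forall>k::int. f ` (int_pts \<inter> slab T k) \<subseteq> G ` slab T k))) \<and>
         (mono_on {1..} (beta TYPE('m)) \<and>
         (\<forall>t::real. t \<ge> 1 \<longrightarrow> beta TYPE('m) t \<ge> 1 \<and>
            2 * of_int \<lfloor>t\<rfloor> - 1 \<le> beta TYPE('m) t \<and>
            beta TYPE('m) t \<le> 2 powr (8 * real (CARD('m) + 1) * t))) \<and>
         (\<forall>(T::nat) G M\<^sub>1 M\<^sub>2. T \<ge> 1 \<and> bilip_on M\<^sub>2 UNIV G \<and>
              bilip_on M\<^sub>1 (int_pts \<union> layers T) (\<lambda>x. if x \<in> int_pts then f x else G x) \<and>
              (\<forall>k::int. f ` (int_pts \<inter> slab T k) \<subseteq> G ` slab T k)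
            \<longrightarrow> (\<exists>F. (\<forall>x\<in>int_pts. F x = f x) \<and>
                  bilip_on ((beta TYPE('m)
                     (2 powr 42 * real (CARD('m) + 1) powr (9/2) * (M\<^sub>1 * M\<^sub>2) ^ 10
                      * real T powr (3 + 3 / real CARD('m)))) ^ (3 ^ CARD('m) + 1)) UNIV F))"
proof (intro conjI allI impI)
  show "(\<exists>F. bilipschitz_on UNIV F \<and> (\<forall>x\<in>int_pts. F x = f x)) \<longleftrightarrow>
           (\<exists>T::nat. \<exists>G. T \<ge> 1 \<and> bilipschitz_on UNIV G \<and>
              bilipschitz_on (int_pts \<union> layers T) (\<lambda>x. if x \<in> int_pts then f x else G x) \<and>
              (\<forall>k::int. f ` (int_pts \<inter> slab T k) \<subseteq> G ` slab T k))" (is "?ext \<longleftrightarrow> ?lay")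
  proof
    assume ?ext
    then obtain F L where F: "bilip_on L UNIV F" "\<forall>x\<in>int_pts. F x = f x"
      unfolding bilipschitz_on_def by blast
    \<comment> \<open>With \<open>G = F\<close> the combined map is \<open>F\<close> itself, so (ii)
      holds already with \<open>T = 1\<close>.\<close>
    have eq: "(\<lambda>x. if x \<in> int_pts then f x else F x) = F" using F(2) by auto
    have "bilip_on L (int_pts \<union> layers 1) F"
      using F(1) unfolding bilip_on_def by (auto intro: inj_on_subset)
    moreover have "f ` (int_pts \<inter> slab 1 k) \<subseteq> F ` slab 1 k" for k
      using F(2) by (auto intro!: rev_image_eqI)
    ultimately show ?lay
      using F(1) unfolding bilipschitz_on_def by (intro exI[of _ 1] exI[of _ F]) (auto simp: eq)
  next
    assume ?lay
    then obtain T :: nat and G M\<^sub>1 M\<^sub>2 where T: "T \<ge> 1" and G: "bilip_on M\<^sub>2 UNIV G"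
      and fG: "bilip_on M\<^sub>1 (int_pts \<union> layers T) (\<lambda>x. if x \<in> int_pts then f x else G x)"
      and slab: "\<forall>k::int. f ` (int_pts \<inter> slab T k) \<subseteq> G ` slab T k"
      unfolding bilipschitz_on_def by blast
    show ?ext
      using extension_from_layers[OF T G fG slab[rule_format]] unfolding bilipschitz_on_def by blast
  qed
next
  show "mono_on {1..} (beta TYPE('m))" by (rule mono_on_beta)
next
  fix t :: real assume "1 \<le> t"
  then show "1 \<le> beta TYPE('m) t" "2 * of_int \<lfloor>t\<rfloor> - 1 \<le> beta TYPE('m) t"
    "beta TYPE('m) t \<le> 2 powr (8 * real (CARD('m) + 1) * t)"
    by (rule beta_ge_1 beta_lower beta_upper)+
next
  fix T :: nat and G and M\<^sub>1 M\<^sub>2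
  assume *: "T \<ge> 1 \<and> bilip_on M\<^sub>2 UNIV G \<and>
    bilip_on M\<^sub>1 (int_pts \<union> layers T) (\<lambda>x. if x \<in> int_pts then f x else G x) \<and>
    (\<forall>k::int. f ` (int_pts \<inter> slab T k) \<subseteq> G ` slab T k)"
  note slab = *[THEN conjunct2, THEN conjunct2, THEN conjunct2, rule_format]
  show "\<exists>F. (\<forall>x\<in>int_pts. F x = f x) \<and>
    bilip_on ((beta TYPE('m)
       (2 powr 42 * real (CARD('m) + 1) powr (9/2) * (M\<^sub>1 * M\<^sub>2) ^ 10
        * real T powr (3 + 3 / real CARD('m)))) ^ (3 ^ CARD('m) + 1)) UNIV F"
    by (rule extension_from_layers[OF *[THEN conjunct1] *[THEN conjunct2, THEN conjunct1]
          *[THEN conjunct2, THEN conjunct2, THEN conjunct1] slab])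
qed

end
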